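(* Let $K_1\ge K_2\ge 0$ be integers, with $K_1\ge 1$ when $K_2=0$. Let $\mathrm{a}_1,\ldots,\mathrm{a}_{K_1}$ be pairwise distinct nonzero real numbers and $\mathrm{b}_1,\ldots,\mathrm{b}_{K_2}$ be pairwise distinct nonzero real numbers, and put \[ G(x,y)=\prod_{j=1}^{K_1}(x-\mathrm{a}_j)\prod_{\ell=1}^{K_2}(y-\mathrm{b}_\ell), \] where the empty product $\prod_{\ell=1}^{0}(y-\mathrm{b}_\ell)$ is $1$. Let $P(x,y),Q(x,y)$ be real polynomials of degree $n$, and consider the perturbed system \[ \dot x=-yG(x,y)+\varepsilon P(x,y),\qquad \dot y=xG(x,y)+\varepsilon Q(x,y), \] with small parameter $\varepsilon$. Let $\rho=\min_{j,\ell}\{|\mathrm{a}_j|,|\mathrm{b}_\ell|\}$ and, for $0<r<\rho$, let \[ I(r)=\int_{\gamma_r}\frac{Q(x,y)\,dx-P(x,y)\,dy}{G(x,y)},\qquad \gamma_r=\{(x,y): x^2+y^2=r^2\}, \] be the associated Abelian integral, and assume $I$ is not identically zero on $(0,\rho)$. Define \[ \widetilde K_1=\operatorname{card}\{|\mathrm{a}_1|,\ldots,|\mathrm{a}_{K_1}|\},\quad \widetilde K_2=\operatorname{card}\{|\mathrm{a}_1|,\ldots,|\mathrm{a}_{K_1}|,|\mathrm{b}_1|,\ldots,|\mathrm{b}_{K_2}|\}-\widetilde K_1, \] \[ L=\operatorname{card}\{\mathrm{a}_j^2+\mathrm{b}_\ell^2 : j=1,\ldots,K_1,\ \ell=1,\ldots,K_2\}.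 \] Then the number $\mathcal Z(I)$ of zeros of $I$ in $(0,\rho)$, counted with multiplicity, satisfies \[ \mathcal Z(I)\le \begin{cases} \widetilde K_1\left[\dfrac{n+3}{2}\right]+\left[\dfrac{n}{2}\right], & K_2=0,\\[2mm] (\widetilde K_1+\widetilde K_2)\left(\left[\dfrac{n+2}{2}\right]+L\right)+\left[\dfrac{n-1}{2}\right]+L, & K_2\ge 1. \end{cases} \] (Here $\widetilde K_1\le K_1$, $\widetilde K_2\le K_2$, $L\le K_1K_2$.)
   Context: $[s]$ denotes the integer part of a real number $s$; $\operatorname{card}$ denotes the number of distinct elements of a set. The circle $\gamma_r$ is traversed once (e.g. counterclockwise, parametrized by $(r\cos\theta,r\sin\theta)$, $\theta\in[0,2\pi]$). For $0<r<\rho$, $G$ does not vanish on $\gamma_r$, so $I(r)$ is well defined and analytic in $r$. *)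

theory Defs
  imports "HOL-Analysis.Analysis"
begin

definition poly2 :: "(nat \<Rightarrow> nat \<Rightarrow> real) \<Rightarrow> nat \<Rightarrow> real \<Rightarrow> real \<Rightarrow> real" where
  "poly2 c n x y = (\<Sum>(i, j) \<in> {(i, j). i + j \<le> n}. c i j * x ^ i * y ^ j)"

definition Gfun :: "nat \<Rightarrow> nat \<Rightarrow> (nat \<Rightarrow> real) \<Rightarrow> (nat \<Rightarrow> real) \<Rightarrow> real \<Rightarrow> real \<Rightarrow> real" where
  "Gfun K1 K2 a b x y = (\<Prod>j = 1..K1. x - a j) * (\<Prod>l = 1..K2. y - b l)"

text \<open>Line integral of (Q dx - P dy)/G over the circle of radius r, traversed once
  counterclockwise via (r cos t, r sin t), t in [0, 2 pi].\<close>
definition abelian_int ::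
  "(real \<Rightarrow> real \<Rightarrow> real) \<Rightarrow> (real \<Rightarrow> real \<Rightarrow> real) \<Rightarrow> (real \<Rightarrow> real \<Rightarrow> real) \<Rightarrow> real \<Rightarrow> real" where
  "abelian_int P Q G r = integral {0..2*pi}
     (\<lambda>t. (Q (r * cos t) (r * sin t) * (- r * sin t) - P (r * cos t) (r * sin t) * (r * cos t))
          / G (r * cos t) (r * sin t))"

definition zero_mult :: "(real \<Rightarrow> real) \<Rightarrow> real \<Rightarrow> nat" where
  "zero_mult f x = (LEAST k. (deriv ^^ k) f x \<noteq> 0)"

end

theory Submission
  imports Defs
begin

text \<open>
  Partial fractions reduce \<open>I\<close> to circle integrals of \<open>x\<^sup>i y\<^sup>j / (x - a)\<close> and
  \<open>x\<^sup>i y\<^sup>j / ((x - a) (y - b))\<close>. Recursion on the exponents gives, with \<open>s = r\<^sup>2\<close> and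
  \<open>\<Lambda>(s)\<close> the product of \<open>l - s\<close> over the \<open>L\<close> distinct values \<open>l = a\<^sub>j\<^sup>2 + b\<^sub>l\<^sup>2\<close>, the closed form
  \<open>\<Lambda>(s) I = A(s) + \<Sum>\<^sub>c p\<^sub>c(s) / sqrt (c - s)\<close>, where \<open>c\<close> runs over the distinct squares of the
  \<open>a\<^sub>j\<close> and \<open>b\<^sub>l\<close>, and \<open>deg A < N\<close>, \<open>deg p\<^sub>c < M\<close> with \<open>M \<le> N + 1\<close>.

  Such a function has fewer than \<open>N + M |C|\<close> zeros. Differentiating \<open>N\<close> times kills \<open>A\<close> and leaves
  a combination of negative powers \<open>(c - s)\<^sup>-\<^sup>\<beta>\<close>, which is the Laplace transform
  \<open>\<integral> exp (s t) W(t) dt\<close> of \<open>W(t) = t\<^sup>\<alpha> \<Sum>\<^sub>c q\<^sub>c(t) exp (- c t)\<close> with \<open>deg q\<^sub>c < M\<close>. By Rolle, \<open>W\<close> has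
  fewer than \<open>M |C|\<close> zeros, and a Laplace transform has at most as many zeros as \<open>W\<close> has sign changes.
\<close>

subsection \<open>Zeros counted with multiplicity\<close>

definition vanishes :: "nat \<Rightarrow> (real \<Rightarrow> real) \<Rightarrow> real \<Rightarrow> bool" where
  "vanishes m f x \<longleftrightarrow> (\<forall>k<m. (deriv ^^ k) f x = 0)"

definition ndiff :: "nat \<Rightarrow> real set \<Rightarrow> (real \<Rightarrow> real) \<Rightarrow> bool" where
  "ndiff m U f \<longleftrightarrow> (\<forall>k<m. \<forall>x\<in>U. (deriv ^^ k) f field_differentiable at x)"

definition zeros_le :: "real set \<Rightarrow> (real \<Rightarrow> real) \<Rightarrow> nat \<Rightarrow> bool" where
  "zeros_le U f N \<longleftrightarrow>
     (\<forall>S m. finite S \<longrightarrow> S \<subseteq> U \<longrightarrow> (\<forall>x\<in>S. vanishes (m x) f x) \<longrightarrow> (\<Sum>x\<in>S. m x) \<le> N)"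

lemma deriv_funpow_Suc: "(deriv ^^ Suc k) f = (deriv ^^ k) (deriv f)"
  by (simp add: funpow_Suc_right del: funpow.simps)

lemma higher_deriv_cong_open:
  assumes "open U" "x \<in> U" "\<And>y. y \<in> U \<Longrightarrow> f y = g y"
  shows "(deriv ^^ k) f x = (deriv ^^ k) g x"
  using assms by (intro higher_deriv_cong_ev refl) (auto simp: eventually_nhds)

lemma vanishes_cong_open:
  assumes "open U" "x \<in> U" "\<And>y. y \<in> U \<Longrightarrow> f y = g y"
  shows "vanishes m f x \<longleftrightarrow> vanishes m g x"
  using higher_deriv_cong_open[OF assms] by (simp add: vanishes_def)

lemma ndiff_cong_open:
  assumes "open U" "\<And>y. y \<in> U \<Longrightarrow> f y = g y"
  shows "ndiff m U f \<longleftrightarrow> ndiff m U g"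
proof -
  have "ndiff m U g" if f: "ndiff m U f" and fg: "\<And>y. y \<in> U \<Longrightarrow> f y = g y" for f g
    unfolding ndiff_def
  proof (intro allI impI ballI)
    fix k x assume "k < m" "x \<in> U"
    then obtain D where D: "((deriv ^^ k) f has_field_derivative D) (at x)"
      using f by (auto simp: ndiff_def field_differentiable_def)
    have "((deriv ^^ k) g has_field_derivative D) (at x)"
      by (rule has_field_derivative_transform_within_open[OF D assms(1) \<open>x \<in> U\<close>])
        (intro higher_deriv_cong_open[OF assms(1)] fg)
    then show "(deriv ^^ k) g field_differentiable at x"
      by (auto simp: field_differentiable_def)
  qed
  then show ?thesis using assms(2) by metis
qed

lemma vanishes_0 [simp]: "vanishes 0 f x"
  by (simp add: vanishes_def)

lemma ndiff_0 [simp]: "ndiff 0 U f"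
  by (simp add: ndiff_def)

lemma ndiff_SucI:
  assumes "open U" "\<And>y. y \<in> U \<Longrightarrow> (f has_real_derivative f' y) (at y)" "ndiff m U f'"
  shows "ndiff (Suc m) U f"
proof -
  have "ndiff m U (deriv f)"
    using assms(3) ndiff_cong_open[OF assms(1), of f' "deriv f"] DERIV_imp_deriv[OF assms(2)] by simp
  then show ?thesis
    unfolding ndiff_def
    using assms(2)
    by (auto simp: deriv_funpow_Suc less_Suc_eq_0_disj field_differentiable_def simp del: funpow.simps(2))
qed

lemma ndiff_SucE:
  assumes "ndiff (Suc m) U f"
  shows "\<And>y. y \<in> U \<Longrightarrow> (f has_real_derivative deriv f y) (at y)" "ndiff m U (deriv f)"
proof -
  show "(f has_real_derivative deriv f y) (at y)" if "y \<in> U" for y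
    using assms that unfolding ndiff_def
    by (metis DERIV_deriv_iff_field_differentiable funpow_0 zero_less_Suc)
  show "ndiff m U (deriv f)"
    using assms unfolding ndiff_def by (auto simp flip: deriv_funpow_Suc)
qed

lemma ndiff_mono: "ndiff m U f \<Longrightarrow> k \<le> m \<Longrightarrow> ndiff k U f"
  by (auto simp: ndiff_def)

lemma ndiff_subset: "ndiff m U f \<Longrightarrow> V \<subseteq> U \<Longrightarrow> ndiff m V f"
  by (auto simp: ndiff_def)

lemma vanishes_mono: "vanishes m f x \<Longrightarrow> k \<le> m \<Longrightarrow> vanishes k f x"
  by (auto simp: vanishes_def)

lemma vanishes_Suc:
  assumes "open U" "x \<in> U" "\<And>y. y \<in> U \<Longrightarrow> (f has_real_derivative f' y) (at y)"
  shows "vanishes (Suc m) f x \<longleftrightarrow> f x = 0 \<and> vanishes m f' x"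
proof -
  have "vanishes m f' x \<longleftrightarrow> vanishes m (deriv f) x"
    by (rule vanishes_cong_open[OF assms(1,2)]) (use DERIV_imp_deriv[OF assms(3)] in simp)
  then show ?thesis
    by (auto simp: vanishes_def deriv_funpow_Suc less_Suc_eq_0_disj simp del: funpow.simps(2))
qed

lemma ndiff_const [simp]: "open U \<Longrightarrow> ndiff m U (\<lambda>x. c)"
proof (induction m arbitrary: c)
  case (Suc m)
  show ?case by (rule ndiff_SucI[where f' = "\<lambda>_. 0"]) (auto intro: Suc)
qed auto

lemma ndiff_ident [simp]: "open U \<Longrightarrow> ndiff m U (\<lambda>x. x)"
  by (cases m) (auto intro!: ndiff_SucI[where f' = "\<lambda>_. 1"] DERIV_ident)

lemma ndiff_add: "open U \<Longrightarrow> ndiff m U f \<Longrightarrow> ndiff m U g \<Longrightarrow> ndiff m U (\<lambda>x. f x + g x)"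
proof (induction m arbitrary: f g)
  case (Suc m)
  show ?case
    by (rule ndiff_SucI[where f' = "\<lambda>x. deriv f x + deriv g x"])
      (use Suc.prems ndiff_SucE[OF Suc.prems(2)] ndiff_SucE[OF Suc.prems(3)] in
        \<open>auto intro!: DERIV_add Suc.IH\<close>)
qed auto

lemma ndiff_mult: "open U \<Longrightarrow> ndiff m U f \<Longrightarrow> ndiff m U g \<Longrightarrow> ndiff m U (\<lambda>x. f x * g x)"
proof (induction m arbitrary: f g)
  case (Suc m)
  have "ndiff m U f" "ndiff m U g"
    using Suc.prems ndiff_mono le_SucI by blast+
  then show ?case
    by (intro ndiff_SucI[where f' = "\<lambda>x. deriv f x * g x + deriv g x * f x"])
      (use Suc.prems ndiff_SucE[OF Suc.prems(2)] ndiff_SucE[OF Suc.prems(3)] in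
        \<open>auto intro!: DERIV_mult Suc.IH ndiff_add\<close>)
qed auto

lemma ndiff_sum: "open U \<Longrightarrow> (\<And>i. i \<in> A \<Longrightarrow> ndiff m U (f i)) \<Longrightarrow> ndiff m U (\<lambda>x. \<Sum>i\<in>A. f i x)"
  by (induction A rule: infinite_finite_induct) (auto intro: ndiff_add)

lemma ndiff_prod: "open U \<Longrightarrow> (\<And>i. i \<in> A \<Longrightarrow> ndiff m U (f i)) \<Longrightarrow> ndiff m U (\<lambda>x. \<Prod>i\<in>A. f i x)"
  by (induction A rule: infinite_finite_induct) (auto intro: ndiff_mult)

lemma ndiff_poly: "open U \<Longrightarrow> ndiff m U (poly p)"
proof (induction p)
  case (pCons c p)
  then show ?case by (simp add: poly_pCons[abs_def] ndiff_add ndiff_mult)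
qed (simp add: poly_0[abs_def])

lemma ndiff_compose:
  "open U \<Longrightarrow> open V \<Longrightarrow> g ` U \<subseteq> V \<Longrightarrow> ndiff m V f \<Longrightarrow> ndiff m U g \<Longrightarrow> ndiff m U (\<lambda>x. f (g x))"
proof (induction m arbitrary: f)
  case (Suc m)
  have "ndiff m U g"
    using Suc.prems ndiff_mono le_SucI by blast
  moreover have "((\<lambda>x. f (g x)) has_real_derivative deriv f (g y) * deriv g y) (at y)" if "y \<in> U" for y
    by (rule DERIV_chain2[OF ndiff_SucE(1)[OF Suc.prems(4)] ndiff_SucE(1)[OF Suc.prems(5)]])
      (use that Suc.prems in auto)
  ultimately show ?case
    by (intro ndiff_SucI[where f' = "\<lambda>x. deriv f (g x) * deriv g x"])
      (use Suc.prems ndiff_SucE(2)[OF Suc.prems(4)] ndiff_SucE(2)[OF Suc.prems(5)] in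
        \<open>auto intro!: Suc.IH ndiff_mult\<close>)
qed auto

lemma ndiff_powr: "ndiff m {0<..} (\<lambda>x. x powr p)"
proof (induction m arbitrary: p)
  case (Suc m)
  show ?case
    by (rule ndiff_SucI[where f' = "\<lambda>x. p * x powr (p - 1)"])
      (auto intro!: ndiff_mult Suc has_real_derivative_powr)
qed auto

lemma ndiff_exp_linear: "ndiff m UNIV (\<lambda>x. exp (c * x))"
proof (induction m)
  case (Suc m)
  show ?case
    by (rule ndiff_SucI[where f' = "\<lambda>x. c * exp (c * x)"])
      (auto intro!: ndiff_mult Suc derivative_eq_intros)
qed auto

lemma vanishes_add:
  assumes "open U" "x \<in> U"
  shows "ndiff m U f \<Longrightarrow> ndiff m U g \<Longrightarrow> vanishes m f x \<Longrightarrow> vanishes m g x \<Longrightarrow> vanishes m (\<lambda>x. f x + g x) x"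
proof (induction m arbitrary: f g)
  case (Suc m)
  note f = ndiff_SucE[OF Suc.prems(1)] and g = ndiff_SucE[OF Suc.prems(2)]
  have v: "f x = 0 \<and> vanishes m (deriv f) x" "g x = 0 \<and> vanishes m (deriv g) x"
    using Suc.prems(3,4) vanishes_Suc[OF assms f(1)] vanishes_Suc[OF assms g(1)] by auto
  have "vanishes m (\<lambda>x. deriv f x + deriv g x) x"
    using v f(2) g(2) by (intro Suc.IH) auto
  then show ?case
    by (subst vanishes_Suc[OF assms DERIV_add[OF f(1) g(1)]]) (use v in auto)
qed auto

lemma vanishes_mult:
  assumes "open U" "x \<in> U"
  shows "ndiff m U f \<Longrightarrow> ndiff m U g \<Longrightarrow> vanishes m f x \<Longrightarrow> vanishes m (\<lambda>x. f x * g x) x"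
proof (induction m arbitrary: f g)
  case (Suc m)
  note f = ndiff_SucE[OF Suc.prems(1)] and g = ndiff_SucE[OF Suc.prems(2)]
  have v: "f x = 0 \<and> vanishes m (deriv f) x"
    using Suc.prems(3) vanishes_Suc[OF assms f(1)] by auto
  have C: "ndiff m U f" "ndiff m U g" and vf: "vanishes m f x"
    using Suc.prems ndiff_mono vanishes_mono le_SucI by blast+
  have "vanishes m (\<lambda>x. f x * deriv g x) x"
    by (rule Suc.IH) (use C g vf in auto)
  then have "vanishes m (\<lambda>x. deriv f x * g x + deriv g x * f x) x"
    using v C f g Suc.IH[of "deriv f" g]
    by (intro vanishes_add[OF assms] ndiff_mult assms) (auto simp: mult.commute)
  then show ?case
    by (subst vanishes_Suc[OF assms DERIV_mult[OF f(1) g(1)]]) (use v in auto)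
qed auto

lemma vanishes_compose:
  assumes "open U" "open V" "g ` U \<subseteq> V" "x \<in> U"
  shows "ndiff m V f \<Longrightarrow> ndiff m U g \<Longrightarrow> vanishes m f (g x) \<Longrightarrow> vanishes m (\<lambda>x. f (g x)) x"
proof (induction m arbitrary: f)
  case (Suc m)
  note f = ndiff_SucE[OF Suc.prems(1)] and g = ndiff_SucE[OF Suc.prems(2)]
  have "g x \<in> V" using assms by auto
  then have v: "f (g x) = 0 \<and> vanishes m (deriv f) (g x)"
    using Suc.prems(3) vanishes_Suc[OF assms(2) _ f(1)] by auto
  have C: "ndiff m U g" using Suc.prems ndiff_mono le_SucI by blast
  have d: "((\<lambda>x. f (g x)) has_real_derivative deriv f (g y) * deriv g y) (at y)" if "y \<in> U" for y
    using that assms by (intro DERIV_chain2 f g) auto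
  have "vanishes m (\<lambda>x. deriv f (g x)) x"
    using v C f by (intro Suc.IH) auto
  then have "vanishes m (\<lambda>x. deriv f (g x) * deriv g x) x"
    by (rule vanishes_mult[OF assms(1,4) ndiff_compose[OF assms(1-3) f(2) C] g(2)])
  then show ?case
    by (subst vanishes_Suc[OF assms(1,4) d]) (use v in auto)
qed auto

lemma zeros_le_subset: "zeros_le U f N \<Longrightarrow> V \<subseteq> U \<Longrightarrow> zeros_le V f N"
  by (auto simp: zeros_le_def)

lemma zeros_le_mono: "zeros_le U f N \<Longrightarrow> N \<le> M \<Longrightarrow> zeros_le U f M"
  unfolding zeros_le_def by (meson order_trans)

lemma zeros_le_vanishes_mono:
  assumes "zeros_le U f N" "\<And>x m. x \<in> U \<Longrightarrow> vanishes m g x \<Longrightarrow> vanishes m f x"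
  shows "zeros_le U g N"
  unfolding zeros_le_def
proof (intro allI impI)
  fix S and m :: "real \<Rightarrow> nat"
  assume S: "finite S" "S \<subseteq> U" "\<forall>x\<in>S. vanishes (m x) g x"
  then have "\<forall>x\<in>S. vanishes (m x) f x"
    using assms(2) by blast
  with S assms(1) show "sum m S \<le> N" unfolding zeros_le_def by blast
qed

lemma zeros_le_cong_open:
  assumes "open U" "\<And>y. y \<in> U \<Longrightarrow> f y = g y" "zeros_le U f N"
  shows "zeros_le U g N"
  by (rule zeros_le_vanishes_mono[OF assms(3)]) (use vanishes_cong_open[of U _ f g] assms in blast)

lemma zeros_le_0:
  assumes "\<And>x. x \<in> U \<Longrightarrow> f x \<noteq> 0"
  shows "zeros_le U f 0"
proof -
  have "m x = 0" if "x \<in> S" "S \<subseteq> U" "\<forall>x\<in>S. vanishes (m x) f x" for x S and m :: "real \<Rightarrow> nat"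
  proof (rule ccontr)
    assume "m x \<noteq> 0"
    then have "f x = 0" using that by (auto simp: vanishes_def dest!: bspec spec[of _ 0])
    with assms that show False by auto
  qed
  then show ?thesis by (auto simp: zeros_le_def)
qed

lemma zeros_le_multD:
  assumes "open U" "\<And>m. ndiff m U f" "\<And>m. ndiff m U g" "zeros_le U (\<lambda>x. f x * g x) N"
  shows "zeros_le U f N"
  by (rule zeros_le_vanishes_mono[OF assms(4)]) (use vanishes_mult[of U _ _ f g] assms in blast)

lemma Rolle_zeros_between:
  fixes f f' :: "real \<Rightarrow> real"
  assumes U: "is_interval U" and f: "\<And>x. x \<in> U \<Longrightarrow> (f has_real_derivative f' x) (at x)"
    and S: "finite S" "S \<noteq> {}" "S \<subseteq> U" "\<And>x. x \<in> S \<Longrightarrow> f x = 0"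
  shows "\<exists>T. finite T \<and> T \<inter> S = {} \<and> T \<subseteq> {..Max S} \<inter> U \<and> Suc (card T) = card S \<and> (\<forall>x\<in>T. f' x = 0)"
  using S
proof (induction S rule: finite_linorder_max_induct)
  case (insert b A)
  show ?case
  proof (cases "A = {}")
    case False
    with insert obtain T where T: "finite T" "T \<inter> A = {}" "T \<subseteq> {..Max A} \<inter> U"
      "Suc (card T) = card A" "\<forall>x\<in>T. f' x = 0" by (metis insert_subset insertCI)
    define c where "c = Max A"
    have c: "c \<in> A" "c < b" using False insert by (auto simp: c_def)
    have sub: "{c..b} \<subseteq> U"
    proof
      fix x assume "x \<in> {c..b}"
      moreover have "c \<in> U" "b \<in> U" using insert.prems c by auto
      ultimately show "x \<in> U" using U unfolding is_interval_1 by (meson atLeastAtMost_iff)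
    qed
    have "\<exists>z>c. z < b \<and> (f' z) = 0"
    proof -
      have "\<exists>z>c. z < b \<and> (\<lambda>h. f' z * h) = (\<lambda>v. 0)"
      proof (rule Rolle_deriv)
        show "continuous_on {c..b} f"
          by (intro continuous_at_imp_continuous_on ballI DERIV_isCont[OF f]) (use sub in blast)
        show "(f has_derivative (*) (f' x)) (at x)" if "c < x" "x < b" for x
          by (rule f[unfolded has_field_derivative_def]) (use sub that in force)
      qed (use c insert.prems in auto)
      then obtain z where z: "z > c" "z < b" "(\<lambda>h. f' z * h) = (\<lambda>v. 0)" by blast
      from fun_cong[OF z(3), of 1] have "f' z = 0" by simp
      with z show ?thesis by blast
    qed
    then obtain z where z: "c < z" "z < b" "f' z = 0" by blast
    have b: "Max (insert b A) = b"
      by (rule Max_eqI) (use insert.hyps less_imp_le in auto)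
    have zA: "z \<notin> A"
    proof
      assume "z \<in> A"
      then have "z \<le> c" unfolding c_def using insert.hyps(1) by (rule Max_ge[rotated])
      with z show False by simp
    qed
    have Tc: "t \<le> c" "t \<in> U" if "t \<in> T" for t using T(3) that by (auto simp: c_def)
    then have zT: "z \<notin> T" "b \<notin> T" using z c by force+
    have "z \<in> U" using sub z by auto
    show ?thesis
    proof (intro exI[of _ "insert z T"] conjI)
      show "insert z T \<inter> insert b A = {}" using T(2) zT zA z(2) by auto
      show "insert z T \<subseteq> {..Max (insert b A)} \<inter> U"
        unfolding b using Tc \<open>z \<in> U\<close> z c by force
      have "b \<notin> A" using insert.hyps(2) by blast
      then show "Suc (card (insert z T)) = card (insert b A)"
        using T zT insert.hyps(1) by simp
    qed (use T z in auto)
  next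
    case True
    then show ?thesis by (intro exI[of _ "{}"]) auto
  qed
qed auto

lemma zeros_le_Rolle:
  assumes U: "is_interval U" "open U" and f: "\<And>x. x \<in> U \<Longrightarrow> (f has_real_derivative f' x) (at x)"
    and N: "zeros_le U f' N"
  shows "zeros_le U f (Suc N)"
  unfolding zeros_le_def
proof (intro allI impI)
  fix S and m :: "real \<Rightarrow> nat"
  assume S: "finite S" "S \<subseteq> U" "\<forall>x\<in>S. vanishes (m x) f x"
  define S' where "S' = {x\<in>S. m x > 0}"
  have S': "finite S'" "S' \<subseteq> U" using S by (auto simp: S'_def)
  have sum: "(\<Sum>x\<in>S. m x) = (\<Sum>x\<in>S'. m x)"
    unfolding S'_def using S by (intro sum.mono_neutral_right) auto
  have v: "f x = 0 \<and> vanishes (m x - 1) f' x" if "x \<in> S'" for x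
  proof -
    have "x \<in> U" "vanishes (Suc (m x - 1)) f x" using that S by (auto simp: S'_def)
    then show ?thesis using vanishes_Suc[OF U(2) _ f] by blast
  qed
  show "sum m S \<le> Suc N"
  proof (cases "S' = {}")
    case False
    obtain T where T: "finite T" "T \<inter> S' = {}" "T \<subseteq> {..Max S'} \<inter> U"
      "Suc (card T) = card S'" "\<forall>x\<in>T. f' x = 0"
      using Rolle_zeros_between[OF U(1) f S'(1) False S'(2)] v by blast
    define m' where "m' x = (if x \<in> T then 1 else m x - 1)" for x
    have "finite (T \<union> S')" "T \<union> S' \<subseteq> U" "\<forall>x\<in>T \<union> S'. vanishes (m' x) f' x"
      using T S' v by (auto simp: m'_def vanishes_def)
    then have "(\<Sum>x\<in>T \<union> S'. m' x) \<le> N"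
      using N unfolding zeros_le_def by blast
    also have "(\<Sum>x\<in>T \<union> S'. m' x) = card T + (\<Sum>x\<in>S'. m x - 1)"
    proof -
      have "sum m' S' = (\<Sum>x\<in>S'. m x - 1)"
        using T(2) by (intro sum.cong) (auto simp: m'_def)
      then show ?thesis using T S' by (subst sum.union_disjoint) (auto simp: m'_def)
    qed
    also have "(\<Sum>x\<in>S'. m x - 1) = (\<Sum>x\<in>S'. m x) - card S'"
      using sum_subtractf_nat[of S' "\<lambda>_. 1" m] by (auto simp: S'_def)
    finally show ?thesis using T(4) sum by linarith
  qed (simp add: sum)
qed

subsection \<open>Exponential polynomials\<close>

definition poly_wt :: "real poly \<Rightarrow> nat" where
  "poly_wt p = (if p = 0 then 0 else Suc (degree p))"

definition exp_poly :: "real set \<Rightarrow> (real \<Rightarrow> real poly) \<Rightarrow> real \<Rightarrow> real" where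
  "exp_poly C q t = (\<Sum>c\<in>C. poly (q c) t * exp (- c * t))"

lemma ndiff_exp_poly: "ndiff m UNIV (exp_poly C q)"
  unfolding exp_poly_def[abs_def] by (intro ndiff_sum ndiff_mult ndiff_poly ndiff_exp_linear) auto

lemma poly_wt_pderiv: "p \<noteq> 0 \<Longrightarrow> Suc (poly_wt (pderiv p)) = poly_wt p"
  by (auto simp: poly_wt_def degree_pderiv pderiv_eq_0_iff)

lemma poly_wt_pderiv_add:
  assumes "k \<noteq> 0"
  shows "poly_wt (pderiv p + smult k p) = poly_wt p"
proof (cases "degree p = 0")
  case True
  then have "pderiv p = 0" by (simp add: pderiv_eq_0_iff)
  then show ?thesis using assms by (simp add: poly_wt_def)
next
  case False
  then have "degree (pderiv p + smult k p) = degree p"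
    using assms by (subst degree_add_eq_right) (auto simp: degree_pderiv)
  with False show ?thesis by (auto simp: poly_wt_def)
qed

lemma exp_poly_zeros_le:
  assumes "finite C" "c0 \<in> C" "q c0 \<noteq> 0"
  shows "zeros_le UNIV (exp_poly C q) ((\<Sum>c\<in>C. poly_wt (q c)) - 1)"
  using assms(2,3)
proof (induction "\<Sum>c\<in>C. poly_wt (q c)" arbitrary: q c0)
  case 0
  then show ?case using assms(1) by (auto simp: poly_wt_def split: if_splits)
next
  case (Suc w)
  define q' where "q' = (\<lambda>c. pderiv (q c) + smult (c0 - c) (q c))"
  have deriv: "((\<lambda>t. exp_poly C q t * exp (c0 * t)) has_real_derivative
      exp_poly C q' t * exp (c0 * t)) (at t)" for t
  proof -
    have "((\<lambda>t. exp_poly C q t * exp (c0 * t)) has_real_derivative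
      (\<Sum>c\<in>C. poly (pderiv (q c)) t * exp (- c * t) + (- c * exp (- c * t)) * poly (q c) t) * exp (c0 * t)
        + c0 * exp (c0 * t) * exp_poly C q t) (at t)"
      unfolding exp_poly_def[abs_def]
      by (intro DERIV_mult DERIV_sum poly_DERIV) (auto intro!: derivative_eq_intros)
    also have "(\<Sum>c\<in>C. poly (pderiv (q c)) t * exp (- c * t) + (- c * exp (- c * t)) * poly (q c) t) * exp (c0 * t)
        + c0 * exp (c0 * t) * exp_poly C q t = exp_poly C q' t * exp (c0 * t)"
      unfolding exp_poly_def q'_def
      by (simp add: sum_distrib_left sum_distrib_right sum.distrib[symmetric] algebra_simps)
    finally show ?thesis .
  qed
  have wt: "Suc (\<Sum>c\<in>C. poly_wt (q' c)) = (\<Sum>c\<in>C. poly_wt (q c))"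
  proof -
    have "(\<Sum>c\<in>C-{c0}. poly_wt (q' c)) = (\<Sum>c\<in>C-{c0}. poly_wt (q c))"
      by (intro sum.cong) (auto simp: q'_def poly_wt_pderiv_add)
    moreover have "Suc (poly_wt (q' c0)) = poly_wt (q c0)"
      using Suc.prems by (simp add: q'_def poly_wt_pderiv)
    ultimately show ?thesis
      using assms(1) Suc.prems by (simp add: sum.remove[of C c0])
  qed
  have "zeros_le UNIV (\<lambda>t. exp_poly C q t * exp (c0 * t)) w"
  proof (cases "w = 0")
    case True
    have "exp_poly C q t * exp (c0 * t) \<noteq> 0" for t
    proof -
      have "poly_wt (q c0) + (\<Sum>c\<in>C-{c0}. poly_wt (q c)) = 1"
        using Suc.hyps(2) True assms(1) Suc.prems by (simp add: sum.remove[of C c0])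
      moreover have "poly_wt (q c0) \<ge> 1" using Suc.prems by (simp add: poly_wt_def)
      ultimately have "poly_wt (q c0) = 1" "(\<Sum>c\<in>C-{c0}. poly_wt (q c)) = 0" by auto
      then have "degree (q c0) = 0" "\<forall>c\<in>C-{c0}. q c = 0"
        using assms(1) by (auto simp: poly_wt_def split: if_splits)
      then have "exp_poly C q t = poly (q c0) t * exp (- c0 * t)"
        unfolding exp_poly_def using assms(1) Suc.prems by (simp add: sum.remove[of C c0])
      moreover have "poly (q c0) t \<noteq> 0"
        using \<open>degree (q c0) = 0\<close> Suc.prems(2) by (metis degree_0_id poly_pCons mult_zero_right add.right_neutral poly_0 pCons_0_0 degree_eq_zeroE)
      ultimately show ?thesis by simp
    qed
    with True show ?thesis by (simp add: zeros_le_0)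
  next
    case False
    then obtain w' where w': "w = Suc w'" by (cases w) auto
    have sum: "(\<Sum>c\<in>C. poly_wt (q' c)) = Suc w'" using wt Suc.hyps(2) w' by simp
    have "\<exists>c1\<in>C. q' c1 \<noteq> 0"
    proof (rule ccontr)
      assume "\<not> (\<exists>c1\<in>C. q' c1 \<noteq> 0)"
      then have "(\<Sum>c\<in>C. poly_wt (q' c)) = 0" by (simp add: poly_wt_def)
      with sum show False by simp
    qed
    then obtain c1 where "c1 \<in> C" "q' c1 \<noteq> 0" by blast
    from Suc.hyps(1)[of q' c1, OF _ this] have "zeros_le UNIV (exp_poly C q') w'"
      using sum w' by simp
    then have "zeros_le UNIV (\<lambda>t. (exp_poly C q' t * exp (c0 * t)) * exp (- c0 * t)) w'"
      by (simp add: mult.assoc flip: exp_add)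
    then have "zeros_le UNIV (\<lambda>t. exp_poly C q' t * exp (c0 * t)) w'"
      by (rule zeros_le_multD[rotated 3]) (rule open_UNIV ndiff_exp_poly ndiff_mult ndiff_exp_linear)+
    then show ?thesis
      unfolding w' by (intro zeros_le_Rolle[OF _ _ deriv]) (auto simp: is_interval_univ)
  qed
  then have "zeros_le UNIV (exp_poly C q) w"
    by (rule zeros_le_multD[rotated 3]) (auto intro!: ndiff_exp_poly ndiff_exp_linear)
  then show ?case using Suc.hyps(2) by (metis diff_Suc_1)
qed

lemma zeros_le_finite:
  assumes "zeros_le U f N"
  shows "finite {x\<in>U. f x = 0}" "card {x\<in>U. f x = 0} \<le> N"
proof -
  have "card S \<le> N" if "finite S" "S \<subseteq> {x\<in>U. f x = 0}" for S
  proof -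
    have "\<forall>x\<in>S. vanishes 1 f x" using that by (auto simp: vanishes_def)
    with that have "(\<Sum>x\<in>S. 1) \<le> N"
      using assms[unfolded zeros_le_def, rule_format, of S "\<lambda>_. 1"] by auto
    then show ?thesis by simp
  qed
  then show "finite {x\<in>U. f x = 0}" "card {x\<in>U. f x = 0} \<le> N"
    by (meson finite_if_finite_subsets_card_bdd order_refl)+
qed

subsection \<open>Laplace transforms and sign changes\<close>

text \<open>The second function is \<open>\<integral> exp (s t) W(t) dt\<close> over \<open>t > 0\<close>, for \<open>s < \<kappa>\<close>.\<close>

inductive laplace_pair :: "real \<Rightarrow> (real \<Rightarrow> real) \<Rightarrow> (real \<Rightarrow> real) \<Rightarrow> bool" for \<kappa> where
  base: "c \<ge> \<kappa> \<Longrightarrow> \<beta> > 0 \<Longrightarrow>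
    laplace_pair \<kappa> (\<lambda>t. t powr (\<beta> - 1) * exp (- c * t)) (\<lambda>s. Gamma \<beta> * (c - s) powr (- \<beta>))"
| zero: "laplace_pair \<kappa> (\<lambda>t. 0) (\<lambda>s. 0)"
| lincomb: "laplace_pair \<kappa> W F \<Longrightarrow> laplace_pair \<kappa> V G \<Longrightarrow>
    laplace_pair \<kappa> (\<lambda>t. W t + x * V t) (\<lambda>s. F s + x * G s)"
| cong: "laplace_pair \<kappa> W F \<Longrightarrow> (\<And>t. t \<ge> 0 \<Longrightarrow> W t = V t) \<Longrightarrow> laplace_pair \<kappa> V F"

lemma Gamma_integral_scaled:
  assumes "\<beta> > 0" "c > (0::real)"
  shows "((\<lambda>t. t powr (\<beta> - 1) * exp (- c * t)) has_integral Gamma \<beta> * c powr (- \<beta>)) {0..}"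
proof -
  have int: "(\<lambda>t. t powr (\<beta> - 1) / exp t) absolutely_integrable_on {0..}"
    using Gamma_integral_real[OF assms(1)]
    by (intro nonnegative_absolutely_integrable_1) (auto simp: has_integral_integrable_integral)
  have img: "(*) c ` {0..} = {0..}"
  proof safe
    fix x :: real assume "x \<ge> 0"
    then show "x \<in> (*) c ` {0..}" using assms by (intro image_eqI[of _ _ "x / c"]) auto
  qed (use assms in auto)
  have "(\<lambda>t. \<bar>c\<bar> * ((c * t) powr (\<beta> - 1) / exp (c * t))) absolutely_integrable_on {0..} \<and>
        integral {0..} (\<lambda>t. \<bar>c\<bar> * ((c * t) powr (\<beta> - 1) / exp (c * t))) = Gamma \<beta>"
  proof (subst has_absolute_integral_change_of_variables_1'[where g = "(*) c" and g' = "\<lambda>_. c"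
        and f = "\<lambda>t. t powr (\<beta> - 1) / exp t"])
    show "((*) c has_real_derivative c) (at x within {0..})" for x
      by (auto intro!: derivative_eq_intros)
    show "(\<lambda>t. t powr (\<beta> - 1) / exp t) absolutely_integrable_on (*) c ` {0..} \<and>
        integral ((*) c ` {0..}) (\<lambda>t. t powr (\<beta> - 1) / exp t) = Gamma \<beta>"
      unfolding img using int Gamma_integral_real[OF assms(1)] by (simp add: integral_unique)
  qed (use assms in \<open>auto simp: inj_on_def\<close>)
  then have "((\<lambda>t. \<bar>c\<bar> * ((c * t) powr (\<beta> - 1) / exp (c * t))) has_integral Gamma \<beta>) {0..}"
    by (simp add: has_integral_integrable_integral absolutely_integrable_on_def)
  then have "((\<lambda>t. c powr (- \<beta>) * (\<bar>c\<bar> * ((c * t) powr (\<beta> - 1) / exp (c * t)))) has_integral c powr (- \<beta>) * Gamma \<beta>) {0..}"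
    by (rule has_integral_mult_right)
  moreover have "c powr (- \<beta>) * (\<bar>c\<bar> * ((c * t) powr (\<beta> - 1) / exp (c * t))) = t powr (\<beta> - 1) * exp (- c * t)"
    if "t \<in> {0..}" for t
  proof -
    have "c powr (- \<beta>) * c * c powr (\<beta> - 1) = 1"
      using assms by (simp add: powr_diff powr_minus field_simps)
    then show ?thesis using assms that by (simp add: powr_mult exp_minus field_simps)
  qed
  ultimately show ?thesis
    by (subst (asm) has_integral_cong) (auto simp: mult.commute)
qed

lemma laplace_pair_has_integral:
  assumes "laplace_pair \<kappa> W F" "s < \<kappa>"
  shows "((\<lambda>t. exp (s * t) * W t) has_integral F s) {0..}"
  using assms(1)
proof induction
  case (base c \<beta>)
  have "exp (s * t) * (t powr (\<beta> - 1) * exp (- c * t)) = t powr (\<beta> - 1) * exp (- (c - s) * t)" for t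
    by (simp add: algebra_simps flip: exp_add)
  then show ?case
    using Gamma_integral_scaled[of \<beta> "c - s"] base assms(2) by (simp only:)
next
  case (lincomb W F V G x)
  from has_integral_add[OF lincomb.IH(1) has_integral_mult_right[OF lincomb.IH(2), of x]]
  show ?case by (simp add: algebra_simps)
next
  case (cong W F V)
  have "((\<lambda>t. exp (s * t) * V t) has_integral F s) {0..} \<longleftrightarrow>
        ((\<lambda>t. exp (s * t) * W t) has_integral F s) {0..}"
    by (intro has_integral_cong) (simp add: cong.hyps(2))
  with cong.IH show ?case by simp
qed simp

lemma laplace_pair_at_0: "laplace_pair \<kappa> W F \<Longrightarrow> W 0 = 0"
  by (induction rule: laplace_pair.induct) auto

lemma laplace_pair_continuous: "laplace_pair \<kappa> W F \<Longrightarrow> continuous_on {0<..} W"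
proof (induction rule: laplace_pair.induct)
  case (cong W F V)
  have "continuous_on {0<..} V \<longleftrightarrow> continuous_on {0<..} W"
    by (rule continuous_on_cong) (use cong.hyps(2) in auto)
  with cong.IH show ?case by simp
qed (auto intro!: continuous_intros)

lemma laplace_pair_Ck: "laplace_pair \<kappa> W F \<Longrightarrow> ndiff m {..<\<kappa>} F"
proof (induction rule: laplace_pair.induct)
  case (base c \<beta>)
  have "ndiff m {..<\<kappa>} (\<lambda>s. c + (-1) * s)"
    by (intro ndiff_add ndiff_mult) auto
  then have "ndiff m {..<\<kappa>} (\<lambda>s. (c + (-1) * s) powr (- \<beta>))"
    by (rule ndiff_compose[where V = "{0<..}", rotated 4, OF _ open_lessThan open_greaterThan _ ndiff_powr])
      (use base in auto)
  then show ?case by (intro ndiff_mult) auto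
qed (auto intro!: ndiff_add ndiff_mult)

lemma laplace_pair_deriv:
  "laplace_pair \<kappa> W F \<Longrightarrow>
     \<exists>F'. laplace_pair \<kappa> (\<lambda>t. t * W t) F' \<and> (\<forall>s<\<kappa>. (F has_real_derivative F' s) (at s))"
proof (induction rule: laplace_pair.induct)
  case (base c \<beta>)
  have "((\<lambda>s. Gamma \<beta> * (c - s) powr (- \<beta>)) has_real_derivative Gamma (\<beta> + 1) * (c - s) powr (- (\<beta> + 1))) (at s)"
    if "s < \<kappa>" for s
    using base that Gamma_plus1[of \<beta>] nonpos_Ints_nonpos[of \<beta>]
    by (force intro!: derivative_eq_intros simp: powr_diff divide_simps)
  moreover have "laplace_pair \<kappa> (\<lambda>t. t * (t powr (\<beta> - 1) * exp (- c * t)))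
      (\<lambda>s. Gamma (\<beta> + 1) * (c - s) powr (- (\<beta> + 1)))"
  proof (rule laplace_pair.cong)
    show "laplace_pair \<kappa> (\<lambda>t. t powr (\<beta> + 1 - 1) * exp (- c * t))
        (\<lambda>s. Gamma (\<beta> + 1) * (c - s) powr (- (\<beta> + 1)))"
      by (rule laplace_pair.base) (use base in auto)
    show "t powr (\<beta> + 1 - 1) * exp (- c * t) = t * (t powr (\<beta> - 1) * exp (- c * t))" if "t \<ge> 0" for t
      using powr_mult_base[OF that, of "\<beta> - 1"] by (simp add: mult.assoc[symmetric])
  qed
  ultimately show ?case by blast
next
  case zero
  show ?case using laplace_pair.zero by (intro exI[of _ "\<lambda>s. 0"]) auto
next
  case (lincomb W F V G x)
  then obtain F' G' where "laplace_pair \<kappa> (\<lambda>t. t * W t) F'" "laplace_pair \<kappa> (\<lambda>t. t * V t) G'"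
    and d: "\<forall>s<\<kappa>. (F has_real_derivative F' s) (at s)" "\<forall>s<\<kappa>. (G has_real_derivative G' s) (at s)"
    by blast
  then have "laplace_pair \<kappa> (\<lambda>t. t * W t + x * (t * V t)) (\<lambda>s. F' s + x * G' s)"
    by (intro laplace_pair.lincomb)
  moreover have "(\<lambda>t. t * W t + x * (t * V t)) = (\<lambda>t. t * (W t + x * V t))"
    by (auto simp: algebra_simps)
  moreover have "((\<lambda>s. F s + x * G s) has_real_derivative F' s + x * G' s) (at s)" if "s < \<kappa>" for s
    by (intro DERIV_add DERIV_cmult) (use d that in auto)
  ultimately show ?case by auto
next
  case (cong W F V)
  then obtain F' where F': "laplace_pair \<kappa> (\<lambda>t. t * W t) F'" "\<forall>s<\<kappa>. (F has_real_derivative F' s) (at s)"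
    by blast
  have "laplace_pair \<kappa> (\<lambda>t. t * V t) F'"
    by (rule laplace_pair.cong[OF F'(1)]) (use cong.hyps(2) in auto)
  with F'(2) show ?case by blast
qed

lemma laplace_pair_nonzero:
  assumes "laplace_pair \<kappa> W F" "s < \<kappa>" "\<And>t. t > 0 \<Longrightarrow> \<sigma> * W t \<ge> 0" "\<sigma> \<noteq> 0" "t0 > 0" "W t0 \<noteq> 0"
  shows "F s \<noteq> 0"
proof
  assume "F s = 0"
  define f where "f t = \<sigma> * (exp (s * t) * W t)" for t
  have I: "(f has_integral 0) {0..}"
    using has_integral_mult_right[OF laplace_pair_has_integral[OF assms(1,2)], of \<sigma>] \<open>F s = 0\<close>
    by (simp add: f_def[abs_def])
  have nonneg: "f t \<ge> 0" if "t \<ge> 0" for t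
  proof (cases "t = 0")
    case False
    with that assms(3)[of t] have "exp (s * t) * (\<sigma> * W t) \<ge> 0" by simp
    then show ?thesis by (simp add: f_def mult_ac)
  qed (simp add: f_def laplace_pair_at_0[OF assms(1)])
  have cont: "continuous_on {t0/2..t0+1} f"
    unfolding f_def using assms(5)
    by (intro continuous_intros continuous_on_subset[OF laplace_pair_continuous[OF assms(1)]]) auto
  then have int: "f integrable_on {t0/2..t0+1}"
    by (rule integrable_continuous_interval)
  have "integral {t0/2..t0+1} f \<le> integral {0..} f"
    using assms(5) I by (intro integral_subset_le int) (auto simp: has_integral_integrable nonneg)
  moreover have "integral {t0/2..t0+1} f \<ge> 0"
    using assms(5) by (intro integral_nonneg int) (auto simp: nonneg)
  ultimately have "(f has_integral 0) (cbox (t0/2) (t0+1))"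
    using I int by (simp add: has_integral_integrable_integral)
  then have "f t0 = 0"
    by (rule has_integral_0_cbox_imp_0[rotated 2]) (use cont nonneg assms(5) in auto)
  with assms show False by (simp add: f_def)
qed

text \<open>Since \<open>(D - \<tau>) F\<close> is the transform of \<open>(t - \<tau>) W\<close>, each removed sign change of \<open>W\<close>
  costs one application of Rolle's theorem to \<open>exp (- \<tau> s) F s\<close>.\<close>

lemma laplace_pair_zeros_le:
  assumes "finite T" "laplace_pair \<kappa> W F" "\<And>t. t > 0 \<Longrightarrow> \<sigma> * (W t * (\<Prod>\<tau>\<in>T. t - \<tau>)) \<ge> 0" "\<sigma> \<noteq> 0"
    "infinite {t. t > 0 \<and> W t \<noteq> 0}"
  shows "zeros_le {..<\<kappa>} F (card T)"
  using assms(1,2,3,5)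
proof (induction T arbitrary: W F rule: finite_induct)
  case empty
  obtain t0 where "t0 > 0" "W t0 \<noteq> 0" using empty.prems(3) not_finite_existsD by auto
  then show ?case
    using laplace_pair_nonzero[OF empty.prems(1) _ _ assms(4)] empty.prems(2)
    by (auto intro!: zeros_le_0)
next
  case (insert \<tau> T)
  obtain F' where F': "laplace_pair \<kappa> (\<lambda>t. t * W t) F'" "\<forall>s<\<kappa>. (F has_real_derivative F' s) (at s)"
    using laplace_pair_deriv[OF insert.prems(1)] by blast
  have "laplace_pair \<kappa> (\<lambda>t. t * W t + (- \<tau>) * W t) (\<lambda>s. F' s + (- \<tau>) * F s)"
    using F' insert.prems by (intro laplace_pair.lincomb)
  then have LT: "laplace_pair \<kappa> (\<lambda>t. (t - \<tau>) * W t) (\<lambda>s. F' s - \<tau> * F s)"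
    by (simp add: algebra_simps)
  have inf: "infinite {t. t > 0 \<and> (t - \<tau>) * W t \<noteq> 0}"
  proof
    assume "finite {t. t > 0 \<and> (t - \<tau>) * W t \<noteq> 0}"
    then have "finite (insert \<tau> {t. t > 0 \<and> (t - \<tau>) * W t \<noteq> 0})" by simp
    then have "finite {t. t > 0 \<and> W t \<noteq> 0}" by (rule finite_subset[rotated]) auto
    with insert.prems(3) show False by simp
  qed
  have "zeros_le {..<\<kappa>} (\<lambda>s. F' s - \<tau> * F s) (card T)"
    using insert.prems(2) insert.hyps by (intro insert.IH[OF LT _ inf]) (simp add: mult_ac)
  then have "zeros_le {..<\<kappa>} (\<lambda>s. ((F' s - \<tau> * F s) * exp (- \<tau> * s)) * exp (\<tau> * s)) (card T)"
    by (simp add: mult.assoc flip: exp_add)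
  then have "zeros_le {..<\<kappa>} (\<lambda>s. (F' s - \<tau> * F s) * exp (- \<tau> * s)) (card T)"
    by (rule zeros_le_multD[rotated 3])
      (rule open_lessThan ndiff_mult laplace_pair_Ck[OF LT] ndiff_subset[OF ndiff_exp_linear subset_UNIV])+
  then have "zeros_le {..<\<kappa>} (\<lambda>s. F s * exp (- \<tau> * s)) (Suc (card T))"
    by (rule zeros_le_Rolle[rotated 3])
      (use F'(2) in \<open>auto simp: is_interval_1 algebra_simps intro!: derivative_eq_intros\<close>)
  then have "zeros_le {..<\<kappa>} F (Suc (card T))"
    by (rule zeros_le_multD[rotated 3])
      (rule open_lessThan laplace_pair_Ck[OF insert.prems(1)] ndiff_subset[OF ndiff_exp_linear subset_UNIV])+
  then show ?case using insert.hyps by simp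
qed

lemma sign_change_set:
  fixes f :: "real \<Rightarrow> real"
  assumes "finite Z" "\<And>x y. 0 < x \<Longrightarrow> x \<le> y \<Longrightarrow> {x..y} \<inter> Z = {} \<Longrightarrow> f x * f y > 0"
  shows "\<exists>T \<sigma>. T \<subseteq> Z \<and> \<sigma> \<noteq> 0 \<and> (\<forall>t>0. t \<notin> Z \<longrightarrow> \<sigma> * (f t * (\<Prod>\<tau>\<in>T. t - \<tau>)) \<ge> 0)"
  using assms
proof (induction Z arbitrary: f rule: finite_induct)
  case empty
  have "f 1 * f t \<ge> 0" if "t > 0" for t
    using empty.prems[of 1 t] empty.prems[of t 1] that by (cases "t \<le> 1") (auto simp: mult.commute)
  moreover have "f 1 \<noteq> 0" using empty.prems[of 1 1] by auto
  ultimately show ?case by (intro exI[of _ "{}"] exI[of _ "f 1"]) auto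
next
  case (insert z Z)
  have sign: "f x * f y > 0" if "0 < x" "0 < y" "{x..y} \<inter> insert z Z = {}" "{y..x} \<inter> insert z Z = {}" for x y
    using insert.prems[of x y] insert.prems[of y x] that by (cases "x \<le> y") (auto simp: mult.commute)
  show ?case
  proof (cases "z > 0")
    case False
    have "f x * f y > 0" if "0 < x" "x \<le> y" "{x..y} \<inter> Z = {}" for x y
      using insert.prems[of x y] that False by auto
    from insert.IH[of f, OF this] obtain T \<sigma> where "T \<subseteq> Z" "\<sigma> \<noteq> 0"
      "\<forall>t>0. t \<notin> Z \<longrightarrow> \<sigma> * (f t * (\<Prod>\<tau>\<in>T. t - \<tau>)) \<ge> 0" by blast
    then show ?thesis by (intro exI[of _ T] exI[of _ \<sigma>]) auto
  next
    case True
    obtain \<epsilon> where \<epsilon>: "\<epsilon> > 0" "\<epsilon> < z" "{z-\<epsilon>..z+\<epsilon>} \<inter> Z = {}"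
    proof -
      have "open (- Z)" "z \<in> - Z" using insert.hyps finite_imp_closed by auto
      then obtain e where e: "e > 0" "cball z e \<subseteq> - Z" using open_contains_cball by blast
      show ?thesis
        by (rule that[of "min e (z/2)"]) (use e True in \<open>auto simp: cball_def dist_real_def subset_iff\<close>)
    qed
    define u v where "u = z - \<epsilon>" and "v = z + \<epsilon>"
    define g where "g = (if f u * f v > 0 then f(z := f u) else (\<lambda>t. f t * (t - z))(z := f v))"
    have left: "f w * f u > 0" if "0 < w" "w < z" "{w..z} \<inter> Z = {}" for w
      by (rule sign) (use that \<epsilon> in \<open>auto simp: u_def disjoint_iff\<close>)
    have right: "f w * f v > 0" if "z < w" "{z..w} \<inter> Z = {}" for w
      by (rule sign) (use that \<epsilon> True in \<open>auto simp: v_def disjoint_iff\<close>)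
    have uv: "f u \<noteq> 0" "f v \<noteq> 0"
      using left[of u] right[of v] \<epsilon> by (auto simp: u_def v_def disjoint_iff)
    have gz: "g w * g z > 0" if "0 < w" "{w..z} \<inter> Z = {}" "{z..w} \<inter> Z = {}" for w
    proof (cases w z rule: linorder_cases)
      case less
      from left[OF that(1) less that(2)] show ?thesis
        using less uv by (auto simp: g_def zero_less_mult_iff mult_less_0_iff)
    next
      case greater
      from right[OF greater that(3)] show ?thesis
        using greater uv by (auto simp: g_def zero_less_mult_iff mult_less_0_iff)
    qed (use uv in \<open>auto simp: g_def zero_less_mult_iff\<close>)
    have "g x * g y > 0" if xy: "0 < x" "x \<le> y" "{x..y} \<inter> Z = {}" for x y
    proof (cases "z \<in> {x..y}")
      case True
      have "g x * g z > 0" "g y * g z > 0"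
        by (rule gz; use xy True in \<open>auto simp: disjoint_iff\<close>)+
      then show ?thesis by (auto simp: zero_less_mult_iff)
    next
      case False
      then have "f x * f y > 0" using insert.prems[of x y] xy by auto
      moreover have "(x - z) * (y - z) > 0" using False xy by (auto simp: zero_less_mult_iff)
      ultimately have "(f x * f y) * ((x - z) * (y - z)) > 0" by simp
      with \<open>f x * f y > 0\<close> False xy show ?thesis by (auto simp: g_def mult_ac)
    qed
    from insert.IH[of g, OF this] obtain T \<sigma> where T: "T \<subseteq> Z" "\<sigma> \<noteq> 0"
      "\<forall>t>0. t \<notin> Z \<longrightarrow> \<sigma> * (g t * (\<Prod>\<tau>\<in>T. t - \<tau>)) \<ge> 0" by blast
    have fin: "finite T" "z \<notin> T" using T(1) insert.hyps finite_subset by auto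
    show ?thesis
    proof (cases "f u * f v > 0")
      case True
      then show ?thesis using T by (intro exI[of _ T] exI[of _ \<sigma>]) (auto simp: g_def)
    next
      case False
      have "\<sigma> * (f t * (\<Prod>\<tau>\<in>insert z T. t - \<tau>)) \<ge> 0" if "t > 0" "t \<notin> insert z Z" for t
        using T(3)[rule_format, of t] that False fin by (auto simp: g_def mult_ac)
      with T show ?thesis by (intro exI[of _ "insert z T"] exI[of _ \<sigma>]) auto
    qed
  qed
qed

lemma continuous_nonzero_same_sign:
  fixes f :: "real \<Rightarrow> real"
  assumes "x \<le> y" "continuous_on {x..y} f" "\<And>t. t \<in> {x..y} \<Longrightarrow> f t \<noteq> 0"
  shows "f x * f y > 0"
proof (rule ccontr)
  assume "\<not> f x * f y > 0"
  then have "(f x \<le> 0 \<and> 0 \<le> f y) \<or> (f y \<le> 0 \<and> 0 \<le> f x)"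
    by (auto simp: zero_less_mult_iff not_less)
  then have "\<exists>t\<ge>x. t \<le> y \<and> f t = 0"
    using IVT'[of f x 0 y] IVT2'[of f y 0 x] assms by blast
  with assms(3) show False by auto
qed

lemma laplace_pair_sum:
  assumes "\<And>i. i \<in> A \<Longrightarrow> laplace_pair \<kappa> (W i) (F i)"
  shows "laplace_pair \<kappa> (\<lambda>t. \<Sum>i\<in>A. x i * W i t) (\<lambda>s. \<Sum>i\<in>A. x i * F i s)"
  using assms
proof (induction A rule: infinite_finite_induct)
  case (insert i A)
  then have "laplace_pair \<kappa> (\<lambda>t. (\<Sum>i\<in>A. x i * W i t) + x i * W i t) (\<lambda>s. (\<Sum>i\<in>A. x i * F i s) + x i * F i s)"
    by (intro laplace_pair.lincomb) auto
  with insert show ?case by (simp add: add.commute)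
qed (auto intro: laplace_pair.zero)

lemma powr_combination_zeros_le:
  fixes \<gamma> :: "real \<Rightarrow> nat \<Rightarrow> real"
  assumes C: "finite C" "\<And>c. c \<in> C \<Longrightarrow> \<kappa> \<le> c" and \<delta>: "\<delta> > real M - 1"
    and nz: "c0 \<in> C" "i0 < M" "\<gamma> c0 i0 \<noteq> 0"
  shows "zeros_le {..<\<kappa>} (\<lambda>s. \<Sum>c\<in>C. \<Sum>i<M. \<gamma> c i * (c - s) powr (real i - \<delta>)) (card C * M - 1)"
proof -
  define w where "w c i = \<gamma> c i / Gamma (\<delta> - real i)" for c i
  define W where "W t = (\<Sum>x\<in>C\<times>{..<M}. w (fst x) (snd x) * (t powr (\<delta> - real (snd x) - 1) * exp (- fst x * t)))" for t
  define q where "q c = (\<Sum>i<M. monom (w c i) (M - 1 - i))" for c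
  have Gamma: "Gamma (\<delta> - real i) > 0" if "i < M" for i
    using \<delta> that by (intro Gamma_real_pos) linarith
  have coeff: "coeff (q c) k = (if k < M then w c (M - 1 - k) else 0)" for c k
  proof -
    have "coeff (q c) k = (\<Sum>i<M. if i = M - 1 - k \<and> k < M then w c i else 0)"
      unfolding q_def coeff_sum coeff_monom by (intro sum.cong) auto
    also have "\<dots> = (if k < M then w c (M - 1 - k) else 0)"
      by (auto simp: sum.delta)
    finally show ?thesis .
  qed
  have "coeff (q c0) (M - 1 - i0) \<noteq> 0"
    using nz Gamma[of i0] by (auto simp: coeff w_def)
  then have q0: "q c0 \<noteq> 0" by auto
  have wt: "poly_wt (q c) \<le> M" for c
  proof (cases "q c = 0")
    case False
    then have "coeff (q c) (degree (q c)) \<noteq> 0" by simp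
    with False show ?thesis by (simp add: poly_wt_def coeff split: if_splits)
  qed (simp add: poly_wt_def)
  have "zeros_le UNIV (exp_poly C q) ((\<Sum>c\<in>C. poly_wt (q c)) - 1)"
    using exp_poly_zeros_le C(1) nz(1) q0 by blast
  moreover have "(\<Sum>c\<in>C. poly_wt (q c)) \<le> card C * M"
    using sum_bounded_above[of C "\<lambda>c. poly_wt (q c)" M] wt by simp
  ultimately have zq: "zeros_le UNIV (exp_poly C q) (card C * M - 1)"
    using zeros_le_mono diff_le_mono by blast
  define Z where "Z = {t. exp_poly C q t = 0}"
  have Z: "finite Z" "card Z \<le> card C * M - 1"
    using zeros_le_finite[OF zq] by (auto simp: Z_def)
  have W_eq: "W t = t powr (\<delta> - real M) * exp_poly C q t" if "t > 0" for t
  proof -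
    have "t powr (\<delta> - real M) * poly (q c) t = (\<Sum>i<M. w c i * t powr (\<delta> - real i - 1))" for c
    proof -
      have "t powr (\<delta> - real M) * t ^ (M - 1 - i) = t powr (\<delta> - real i - 1)" if "i < M" for i
      proof -
        have "t ^ (M - 1 - i) = t powr real (M - 1 - i)" using \<open>t > 0\<close> by (simp add: powr_realpow)
        also have "real (M - 1 - i) = real M - 1 - real i" using that by (simp add: of_nat_diff)
        finally show ?thesis by (simp add: powr_add[symmetric] algebra_simps)
      qed
      then show ?thesis
        by (simp add: q_def poly_sum poly_monom sum_distrib_left mult_ac)
    qed
    then have "t powr (\<delta> - real M) * exp_poly C q t = (\<Sum>c\<in>C. (\<Sum>i<M. w c i * t powr (\<delta> - real i - 1)) * exp (- c * t))"
      by (simp add: exp_poly_def sum_distrib_left mult.assoc[symmetric])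
    then show ?thesis
      by (simp add: W_def sum.cartesian_product' sum_distrib_right mult.assoc)
  qed
  have cont: "continuous_on X (exp_poly C q)" for X
    unfolding exp_poly_def by (intro continuous_intros)
  obtain T \<sigma> where T: "T \<subseteq> Z" "\<sigma> \<noteq> 0"
    "\<forall>t>0. t \<notin> Z \<longrightarrow> \<sigma> * (exp_poly C q t * (\<Prod>\<tau>\<in>T. t - \<tau>)) \<ge> 0"
  proof -
    have "\<exists>T \<sigma>. T \<subseteq> Z \<and> \<sigma> \<noteq> 0 \<and> (\<forall>t>0. t \<notin> Z \<longrightarrow> \<sigma> * (exp_poly C q t * (\<Prod>\<tau>\<in>T. t - \<tau>)) \<ge> 0)"
    proof (rule sign_change_set[OF Z(1)])
      fix x y :: real
      assume "x \<le> y" "{x..y} \<inter> Z = {}"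
      then show "exp_poly C q x * exp_poly C q y > 0"
        by (intro continuous_nonzero_same_sign cont) (auto simp: Z_def)
    qed
    then show ?thesis using that by (elim exE conjE)
  qed
  have "laplace_pair \<kappa> W (\<lambda>s. \<Sum>x\<in>C\<times>{..<M}. w (fst x) (snd x) * (Gamma (\<delta> - real (snd x)) * (fst x - s) powr (- (\<delta> - real (snd x)))))"
    unfolding W_def
    by (intro laplace_pair_sum laplace_pair.base) (use C \<delta> in force)+
  moreover have "(\<Sum>x\<in>C\<times>{..<M}. w (fst x) (snd x) * (Gamma (\<delta> - real (snd x)) * (fst x - s) powr (- (\<delta> - real (snd x)))))
      = (\<Sum>c\<in>C. \<Sum>i<M. \<gamma> c i * (c - s) powr (real i - \<delta>))" for s
  proof -
    have "w c i * (Gamma (\<delta> - real i) * (c - s) powr (- (\<delta> - real i))) = \<gamma> c i * (c - s) powr (real i - \<delta>)"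
      if "i < M" for c i
      using Gamma[OF that] by (simp add: w_def)
    then show ?thesis
      unfolding sum.cartesian_product' fst_conv snd_conv by (intro sum.cong refl) auto
  qed
  ultimately have LT: "laplace_pair \<kappa> W (\<lambda>s. \<Sum>c\<in>C. \<Sum>i<M. \<gamma> c i * (c - s) powr (real i - \<delta>))"
    by simp
  have "zeros_le {..<\<kappa>} (\<lambda>s. \<Sum>c\<in>C. \<Sum>i<M. \<gamma> c i * (c - s) powr (real i - \<delta>)) (card T)"
  proof (rule laplace_pair_zeros_le[OF _ LT _ T(2)])
    show "finite T" using T(1) Z(1) finite_subset by blast
    show "\<sigma> * (W t * (\<Prod>\<tau>\<in>T. t - \<tau>)) \<ge> 0" if "t > 0" for t
    proof (cases "t \<in> Z")
      case True
      then show ?thesis using W_eq[OF that] by (simp add: Z_def)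
    next
      case False
      then have "t powr (\<delta> - real M) * (\<sigma> * (exp_poly C q t * (\<Prod>\<tau>\<in>T. t - \<tau>))) \<ge> 0"
        using T(3) that by simp
      then show ?thesis using W_eq[OF that] by (simp add: mult_ac)
    qed
    have "{t. t > 0 \<and> W t \<noteq> 0} = {0<..} - Z" using W_eq by (auto simp: Z_def)
    then show "infinite {t. t > 0 \<and> W t \<noteq> 0}"
      using Z(1) infinite_Ioi[of "0::real"] by (simp add: Diff_infinite_finite)
  qed
  then show ?thesis
    by (rule zeros_le_mono) (use card_mono[OF Z(1) T(1)] Z(2) in linarith)
qed

lemma poly_powr_combination_zeros_le:
  fixes \<gamma> :: "real \<Rightarrow> nat \<Rightarrow> real"
  assumes C: "finite C" "\<And>c. c \<in> C \<Longrightarrow> \<kappa> \<le> c" and nz: "c0 \<in> C" "i0 < M"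
  shows "\<gamma> c0 i0 \<noteq> 0 \<Longrightarrow> \<delta> > real M - 1 - real N \<Longrightarrow> \<delta> \<notin> \<int> \<Longrightarrow> (\<forall>i\<ge>N. coeff A i = 0) \<Longrightarrow>
    zeros_le {..<\<kappa>} (\<lambda>s. poly A s + (\<Sum>c\<in>C. \<Sum>i<M. \<gamma> c i * (c - s) powr (real i - \<delta>))) (card C * M - 1 + N)"
proof (induction N arbitrary: \<gamma> \<delta> A)
  case 0
  then have "A = 0" by (simp add: poly_eqI)
  with 0 show ?case
    using powr_combination_zeros_le[OF C, of M \<delta> c0 i0 \<gamma>] nz by simp
next
  case (Suc N)
  define \<gamma>' where "\<gamma>' c i = (\<delta> - real i) * \<gamma> c i" for c i
  have "\<delta> - real i0 \<noteq> 0" using Suc.prems(3) by auto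
  then have "zeros_le {..<\<kappa>} (\<lambda>s. poly (pderiv A) s + (\<Sum>c\<in>C. \<Sum>i<M. \<gamma>' c i * (c - s) powr (real i - (\<delta> + 1))))
      (card C * M - 1 + N)"
    by (intro Suc.IH) (use Suc.prems in \<open>auto simp: \<gamma>'_def coeff_pderiv\<close>)
  moreover have "((\<lambda>s. poly A s + (\<Sum>c\<in>C. \<Sum>i<M. \<gamma> c i * (c - s) powr (real i - \<delta>))) has_real_derivative
      poly (pderiv A) s + (\<Sum>c\<in>C. \<Sum>i<M. \<gamma>' c i * (c - s) powr (real i - (\<delta> + 1)))) (at s)"
    if "s \<in> {..<\<kappa>}" for s
  proof (intro DERIV_add poly_DERIV DERIV_sum)
    fix c i assume "c \<in> C"
    then have "c - s > 0" using C(2)[of c] that by auto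
    then show "((\<lambda>s. \<gamma> c i * (c - s) powr (real i - \<delta>)) has_real_derivative
        \<gamma>' c i * (c - s) powr (real i - (\<delta> + 1))) (at s)"
      by (auto intro!: derivative_eq_intros simp: \<gamma>'_def algebra_simps)
  qed
  ultimately show ?case
    unfolding add_Suc_right by (intro zeros_le_Rolle) (auto simp: is_interval_1)
qed

lemma poly_sqrt_combination_zeros_le:
  assumes C: "finite C" "\<And>c. c \<in> C \<Longrightarrow> \<kappa> \<le> c"
    and A: "\<And>i. i \<ge> N \<Longrightarrow> coeff A i = 0" and p: "\<And>c i. i \<ge> M \<Longrightarrow> coeff (p c) i = 0"
    and NM: "M \<le> N + 1"
    and f: "\<And>s. s < \<kappa> \<Longrightarrow> f s = poly A s + (\<Sum>c\<in>C. poly (p c) s / sqrt (c - s))"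
    and nz: "s0 < \<kappa>" "f s0 \<noteq> 0"
  shows "zeros_le {..<\<kappa>} f (card C * M + N - 1)"
proof (cases "\<forall>c\<in>C. p c = 0")
  case True
  then have fA: "f s = poly A s" if "s < \<kappa>" for s using f[OF that] by simp
  with nz have "A \<noteq> 0" by auto
  have "exp_poly {0} (\<lambda>_. A) = poly A" by (auto simp: exp_poly_def)
  then have "zeros_le UNIV (poly A) (degree A)"
    using exp_poly_zeros_le[of "{0}" 0 "\<lambda>_. A"] \<open>A \<noteq> 0\<close> by (simp add: poly_wt_def)
  then have "zeros_le {..<\<kappa>} (poly A) (degree A)" by (rule zeros_le_subset) auto
  then have "zeros_le {..<\<kappa>} f (degree A)"
    by (rule zeros_le_cong_open[rotated 2]) (auto simp: fA)
  moreover have "degree A < N" using A[of "degree A"] \<open>A \<noteq> 0\<close> not_less by auto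
  ultimately show ?thesis by (elim zeros_le_mono) linarith
next
  case False
  then obtain c0 where c0: "c0 \<in> C" "p c0 \<noteq> 0" by blast
  define q where "q c = pcompose (p c) [:c, -1:]" for c
  have deg: "degree (q c) = degree (p c)" for c by (simp add: q_def degree_pcompose)
  have pz: "p c = 0 \<or> degree (p c) < M" for c
    using p[of "degree (p c)" c] by (cases "p c = 0") (auto simp flip: not_less)
  have q_0: "q c0 \<noteq> 0" using c0 by (simp add: q_def pcompose_eq_0_iff)
  define i0 where "i0 = degree (q c0)"
  have "coeff (q c0) i0 \<noteq> 0" unfolding i0_def using q_0 by (rule leading_coeff_neq_0)
  moreover have "i0 < M" using pz[of c0] c0 by (simp add: i0_def deg)
  ultimately have i0: "i0 < M" "coeff (q c0) i0 \<noteq> 0" by auto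
  have eq: "poly (p c) s / sqrt (c - s) = (\<Sum>i<M. coeff (q c) i * (c - s) powr (real i - 1/2))"
    if "s < \<kappa>" "c \<in> C" for s c
  proof -
    have pos: "c - s > 0" using C(2)[of c] that by auto
    have "poly (p c) s = poly (q c) (c - s)" by (simp add: q_def poly_pcompose)
    also have "\<dots> = (\<Sum>i\<le>degree (q c). coeff (q c) i * (c - s) ^ i)" by (rule poly_altdef)
    also have "\<dots> = (\<Sum>i<M. coeff (q c) i * (c - s) ^ i)"
    proof (cases "p c = 0")
      case True
      then show ?thesis by (simp add: q_def)
    next
      case False
      then show ?thesis using pz[of c]
        by (intro sum.mono_neutral_left) (auto simp: deg coeff_eq_0)
    qed
    finally have "poly (p c) s / sqrt (c - s) = (\<Sum>i<M. coeff (q c) i * ((c - s) ^ i / sqrt (c - s)))"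
      by (simp add: sum_divide_distrib)
    also have "\<dots> = (\<Sum>i<M. coeff (q c) i * (c - s) powr (real i - 1/2))"
      using pos by (intro sum.cong) (auto simp: powr_diff powr_realpow powr_half_sqrt)
    finally show ?thesis .
  qed
  have "(1/2 :: real) \<notin> \<int>"
    using fraction_not_in_Ints[of 2 1, where 'a = real] by simp
  then have "zeros_le {..<\<kappa>} (\<lambda>s. poly A s + (\<Sum>c\<in>C. \<Sum>i<M. coeff (q c) i * (c - s) powr (real i - 1/2)))
      (card C * M - 1 + N)"
    using i0 c0 NM A by (intro poly_powr_combination_zeros_le[OF C, of c0 i0]) auto
  then have "zeros_le {..<\<kappa>} f (card C * M - 1 + N)"
    by (rule zeros_le_cong_open[rotated 2]) (auto simp: f eq)
  moreover have "card C * M - 1 + N \<le> card C * M + N - 1"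
    using c0 C(1) i0 by (cases "card C") auto
  ultimately show ?thesis by (rule zeros_le_mono)
qed

subsection \<open>Integrals over circles\<close>

definition circ_int :: "(real \<Rightarrow> real \<Rightarrow> real) \<Rightarrow> real \<Rightarrow> real" where
  "circ_int u r = integral {0..2*pi} (\<lambda>t. u (r * cos t) (r * sin t))"

definition circ_cont :: "(real \<Rightarrow> real \<Rightarrow> real) \<Rightarrow> real \<Rightarrow> bool" where
  "circ_cont u r \<longleftrightarrow> continuous_on UNIV (\<lambda>t. u (r * cos t) (r * sin t))"

lemma circ_cont_integrable:
  "circ_cont u r \<Longrightarrow> (\<lambda>t. u (r * cos t) (r * sin t)) integrable_on {c..d}"
  unfolding circ_cont_def by (intro integrable_continuous_interval) (auto intro: continuous_on_subset)

lemma circ_int_add: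
  "circ_cont u r \<Longrightarrow> circ_cont v r \<Longrightarrow> circ_int (\<lambda>x y. u x y + v x y) r = circ_int u r + circ_int v r"
  unfolding circ_int_def by (intro integral_add circ_cont_integrable)

lemma circ_int_cmult: "circ_int (\<lambda>x y. k * u x y) r = k * circ_int u r"
  unfolding circ_int_def by simp

lemma circ_int_sum:
  "finite A \<Longrightarrow> (\<And>i. i \<in> A \<Longrightarrow> circ_cont (u i) r) \<Longrightarrow>
     circ_int (\<lambda>x y. \<Sum>i\<in>A. u i x y) r = (\<Sum>i\<in>A. circ_int (u i) r)"
  unfolding circ_int_def by (intro integral_sum circ_cont_integrable)

lemma circ_int_cong:
  assumes "r \<ge> 0" "\<And>x y. \<bar>x\<bar> \<le> r \<Longrightarrow> \<bar>y\<bar> \<le> r \<Longrightarrow> x\<^sup>2 + y\<^sup>2 = r\<^sup>2 \<Longrightarrow> u x y = v x y"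
  shows "circ_int u r = circ_int v r"
proof -
  have "u (r * cos t) (r * sin t) = v (r * cos t) (r * sin t)" for t
  proof (rule assms(2))
    show "\<bar>r * cos t\<bar> \<le> r" "\<bar>r * sin t\<bar> \<le> r"
      using assms(1) abs_cos_le_one[of t] abs_sin_le_one[of t]
      by (auto simp: abs_mult intro: mult_left_le)
    show "(r * cos t)\<^sup>2 + (r * sin t)\<^sup>2 = r\<^sup>2"
      by (simp add: power_mult_distrib flip: distrib_left)
  qed
  then show ?thesis by (simp add: circ_int_def)
qed

lemma integral_periodic_shift:
  fixes f :: "real \<Rightarrow> real"
  assumes "continuous_on UNIV f" "\<And>t. f (t + 2 * pi) = f t" "0 \<le> c" "c \<le> 2 * pi"
  shows "integral {c..c + 2 * pi} f = integral {0..2*pi} f"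
proof -
  have int: "f integrable_on {x..y}" for x y
    using assms(1) by (intro integrable_continuous_interval) (auto intro: continuous_on_subset)
  have "integral {2*pi..c + 2 * pi} f = integral {0..c} f"
    using integral_shift_real_ivl[of "2*pi" "2*pi" "c + 2*pi" f] assms(2) by simp
  moreover have "integral {c..2*pi} f + integral {2*pi..c + 2 * pi} f = integral {c..c + 2 * pi} f"
    using assms int by (intro Henstock_Kurzweil_Integration.integral_combine) auto
  moreover have "integral {0..c} f + integral {c..2*pi} f = integral {0..2*pi} f"
    using assms int by (intro Henstock_Kurzweil_Integration.integral_combine) auto
  ultimately show ?thesis by linarith
qed

lemma circ_int_reflect:
  assumes "circ_cont u r" "0 \<le> c" "c \<le> 2 * pi"
  shows "integral {0..2*pi} (\<lambda>t. u (r * cos (c - t)) (r * sin (c - t))) = circ_int u r"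
proof -
  define f where "f t = u (r * cos t) (r * sin t)" for t
  have per: "f (t + 2 * pi) = f t" for t by (simp add: f_def)
  have "integral {0..2*pi} (\<lambda>t. f (c - t)) = integral {-(2*pi)..0} (\<lambda>t. f (c + t))"
    using Henstock_Kurzweil_Integration.integral_reflect_real[of 0 "-(2*pi)" "\<lambda>t. f (c + t)"] by simp
  also have "\<dots> = integral {-(2*pi)..0} (\<lambda>t. f (t + (c + 2 * pi)))"
    using per by (metis (no_types, opaque_lifting) add.assoc add.commute)
  also have "\<dots> = integral {c..c + 2 * pi} f"
    using integral_shift_real_ivl[of c "c + 2*pi" "c + 2*pi" f] by simp
  also have "\<dots> = integral {0..2*pi} f"
    using assms per by (intro integral_periodic_shift) (auto simp: f_def[abs_def] circ_cont_def)
  finally show ?thesis by (simp add: f_def[abs_def] circ_int_def)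
qed

lemma circ_int_symmetries:
  assumes "circ_cont u r"
  shows "circ_int (\<lambda>x y. u (- x) y) r = circ_int u r"
    and "circ_int (\<lambda>x y. u x (- y)) r = circ_int u r"
    and "circ_int (\<lambda>x y. u y x) r = circ_int u r"
  using circ_int_reflect[OF assms, of pi] circ_int_reflect[OF assms, of "2*pi"]
    circ_int_reflect[OF assms, of "pi/2"]
  by (simp_all add: circ_int_def cos_diff sin_diff)

lemma integral_recip_cos:
  assumes "\<bar>k\<bar> < (1::real)"
  shows "integral {0..2*pi} (\<lambda>t. 1 / (1 + k * cos t)) = 2 * pi / sqrt (1 - k\<^sup>2)"
proof -
  define w where "w = sqrt (1 - k\<^sup>2)"
  have k2: "k\<^sup>2 < 1" using assms by (simp add: abs_square_less_1)
  then have w: "w > 0" "w\<^sup>2 = 1 - k\<^sup>2" by (auto simp: w_def)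
  define F where "F t = (t - 2 * arctan (k * sin t / (1 + w + k * cos t))) / w" for t
  have kc: "1 + k * cos t > 0" for t
  proof -
    have "\<bar>k * cos t\<bar> \<le> \<bar>k\<bar>" by (simp add: abs_mult mult_left_le)
    then show ?thesis using assms by linarith
  qed
  have "(F has_real_derivative 1 / (1 + k * cos t)) (at t)" for t
  proof -
    define D where "D = 1 + w + k * cos t"
    have D: "D > 0" using kc[of t] w by (simp add: D_def)
    have sum: "D\<^sup>2 + (k * sin t)\<^sup>2 = 2 * (1 + w) * (1 + k * cos t)"
    proof -
      have "D\<^sup>2 + (k * sin t)\<^sup>2 = (1 + w)\<^sup>2 + 2 * (1 + w) * (k * cos t) + k\<^sup>2 * ((cos t)\<^sup>2 + (sin t)\<^sup>2)"
        unfolding D_def by algebra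
      also have "\<dots> = (1 + w)\<^sup>2 + 2 * (1 + w) * (k * cos t) + (1 - w\<^sup>2)" using w by simp
      also have "\<dots> = 2 * (1 + w) * (1 + k * cos t)" by (simp add: power2_eq_square algebra_simps)
      finally show ?thesis .
    qed
    have num: "k * cos t * D + k * sin t * (k * sin t) = (1 + w) * (1 + k * cos t - w)"
    proof -
      have "k * cos t * D + k * sin t * (k * sin t) = (1 + w) * (k * cos t) + k\<^sup>2 * ((cos t)\<^sup>2 + (sin t)\<^sup>2)"
        unfolding D_def by algebra
      also have "\<dots> = (1 + w) * (k * cos t) + (1 - w\<^sup>2)" using w by simp
      also have "\<dots> = (1 + w) * (1 + k * cos t - w)" by (simp add: power2_eq_square algebra_simps)
      finally show ?thesis .
    qed
    have quot: "((\<lambda>t. k * sin t / (1 + w + k * cos t)) has_real_derivative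
        (k * cos t * D + k * sin t * (k * sin t)) / D\<^sup>2) (at t)"
      using D unfolding D_def by (auto intro!: derivative_eq_intros simp: power2_eq_square)
    have "((\<lambda>t. arctan (k * sin t / (1 + w + k * cos t))) has_real_derivative
        inverse (1 + (k * sin t / D)\<^sup>2) * ((k * cos t * D + k * sin t * (k * sin t)) / D\<^sup>2)) (at t)"
      unfolding D_def by (rule DERIV_chain2[OF DERIV_arctan quot[unfolded D_def]])
    also have "inverse (1 + (k * sin t / D)\<^sup>2) * ((k * cos t * D + k * sin t * (k * sin t)) / D\<^sup>2)
        = ((1 + w) * (1 + k * cos t - w)) / (D\<^sup>2 + (k * sin t)\<^sup>2)"
    proof -
      have "1 + (k * sin t / D)\<^sup>2 = (D\<^sup>2 + (k * sin t)\<^sup>2) / D\<^sup>2"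
        using D by (simp add: power_divide add_divide_distrib)
      then show ?thesis unfolding num using D by (simp only: inverse_divide) simp
    qed
    also have "\<dots> = (1 - w / (1 + k * cos t)) / 2"
    proof -
      have "v * (e - w) / (2 * v * e) = (1 - w / e) / 2" if "v > 0" "e > 0" for v e
        using that by (simp add: field_simps)
      then show ?thesis unfolding sum using w(1) kc[of t] by (metis add_pos_pos zero_less_one)
    qed
    finally have "(F has_real_derivative (1 - 2 * ((1 - w / (1 + k * cos t)) / 2)) / w) (at t)"
      unfolding F_def by (intro DERIV_cdivide DERIV_diff DERIV_cmult DERIV_ident)
    moreover have "(1 - 2 * ((1 - w / e) / 2)) / w = 1 / e" for e
      using w(1) by (simp add: diff_divide_distrib)
    ultimately show ?thesis by (simp only:)
  qed
  then have "((\<lambda>t. 1 / (1 + k * cos t)) has_integral F (2*pi) - F 0) {0..2*pi}"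
    by (intro fundamental_theorem_of_calculus)
      (auto simp: has_real_derivative_iff_has_vector_derivative[symmetric] intro: has_field_derivative_at_within)
  then show ?thesis by (simp add: integral_unique F_def w_def)
qed

lemma circ_int_recip:
  assumes "0 < r" "r < \<bar>a\<bar>"
  shows "circ_int (\<lambda>x y. 1 / (x - a)) r = - (2 * pi * sgn a) / sqrt (a\<^sup>2 - r\<^sup>2)"
proof -
  have a: "a \<noteq> 0" using assms by auto
  have "circ_int (\<lambda>x y. 1 / (x - a)) r = integral {0..2*pi} (\<lambda>t. (- 1 / a) * (1 / (1 + (- r / a) * cos t)))"
  proof -
    have "1 / (z - a) = (- 1 / a) * (1 / (1 - z / a))" for z
      using a by (cases "z = a") (auto simp: field_simps)
    then show ?thesis unfolding circ_int_def by (intro integral_cong) simp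
  qed
  also have "\<dots> = (- 1 / a) * (2 * pi / sqrt (1 - (- r / a)\<^sup>2))"
    using assms by (subst integral_mult_right, subst integral_recip_cos) (auto simp: abs_divide)
  also have "1 - (- r / a)\<^sup>2 = (a\<^sup>2 - r\<^sup>2) / a\<^sup>2" using a by (simp add: field_simps)
  also have "sqrt ((a\<^sup>2 - r\<^sup>2) / a\<^sup>2) = sqrt (a\<^sup>2 - r\<^sup>2) / \<bar>a\<bar>" by (simp add: real_sqrt_divide)
  finally show ?thesis using a by (simp add: sgn_real_def field_simps abs_if split: if_splits)
qed

definition sqrt_class :: "real set \<Rightarrow> real \<Rightarrow> nat \<Rightarrow> nat \<Rightarrow> (real \<Rightarrow> real) \<Rightarrow> bool" where
  "sqrt_class C \<rho> N M f \<longleftrightarrow> (\<exists>A p. (\<forall>i\<ge>N. coeff A i = 0) \<and> (\<forall>c. \<forall>i\<ge>M. coeff (p c) i = 0) \<and>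
     (\<forall>r\<in>{0<..<\<rho>}. f r = poly A (r\<^sup>2) + (\<Sum>c\<in>C. poly (p c) (r\<^sup>2) / sqrt (c - r\<^sup>2))))"

lemma sqrt_class_cong:
  assumes "\<And>r. 0 < r \<Longrightarrow> r < \<rho> \<Longrightarrow> f r = g r" "sqrt_class C \<rho> N M f"
  shows "sqrt_class C \<rho> N M g"
proof -
  have "(\<forall>r\<in>{0<..<\<rho>}. g r = h r) \<longleftrightarrow> (\<forall>r\<in>{0<..<\<rho>}. f r = h r)" for h
    using assms(1) by (intro ball_cong) auto
  then show ?thesis using assms(2) unfolding sqrt_class_def by (simp only:)
qed

lemma sqrt_class_mono:
  assumes "sqrt_class C \<rho> N M f" "N \<le> N'" "M \<le> M'"
  shows "sqrt_class C \<rho> N' M' f"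
proof -
  obtain A p where "\<forall>i\<ge>N. coeff A i = 0" "\<forall>c. \<forall>i\<ge>M. coeff (p c) i = 0"
    "\<forall>r\<in>{0<..<\<rho>}. f r = poly A (r\<^sup>2) + (\<Sum>c\<in>C. poly (p c) (r\<^sup>2) / sqrt (c - r\<^sup>2))"
    using assms unfolding sqrt_class_def by blast
  with assms(2,3) show ?thesis
    unfolding sqrt_class_def by (intro exI[of _ A] exI[of _ p]) auto
qed

lemma sqrt_class_poly:
  assumes "\<And>i. i \<ge> N \<Longrightarrow> coeff A i = 0"
  shows "sqrt_class C \<rho> N M (\<lambda>r. poly A (r\<^sup>2))"
  unfolding sqrt_class_def by (rule exI[of _ A], rule exI[of _ "\<lambda>_. 0"]) (use assms in auto)

lemma sqrt_class_add:
  assumes "sqrt_class C \<rho> N M f" "sqrt_class C \<rho> N M g"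
  shows "sqrt_class C \<rho> N M (\<lambda>r. f r + g r)"
proof -
  obtain A p B q where "\<forall>i\<ge>N. coeff A i = 0" "\<forall>c. \<forall>i\<ge>M. coeff (p c) i = 0"
    "\<forall>r\<in>{0<..<\<rho>}. f r = poly A (r\<^sup>2) + (\<Sum>c\<in>C. poly (p c) (r\<^sup>2) / sqrt (c - r\<^sup>2))"
    "\<forall>i\<ge>N. coeff B i = 0" "\<forall>c. \<forall>i\<ge>M. coeff (q c) i = 0"
    "\<forall>r\<in>{0<..<\<rho>}. g r = poly B (r\<^sup>2) + (\<Sum>c\<in>C. poly (q c) (r\<^sup>2) / sqrt (c - r\<^sup>2))"
    using assms unfolding sqrt_class_def by blast
  then show ?thesis
    unfolding sqrt_class_def
    by (intro exI[of _ "A + B"] exI[of _ "\<lambda>c. p c + q c"]) (auto simp: add_divide_distrib sum.distrib)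
qed

lemma sqrt_class_affine_mult:
  assumes "sqrt_class C \<rho> N M f"
  shows "sqrt_class C \<rho> (Suc N) (Suc M) (\<lambda>r. (k + l * r\<^sup>2) * f r)"
proof -
  obtain A p where Ap: "\<forall>i\<ge>N. coeff A i = 0" "\<forall>c. \<forall>i\<ge>M. coeff (p c) i = 0"
    "\<forall>r\<in>{0<..<\<rho>}. f r = poly A (r\<^sup>2) + (\<Sum>c\<in>C. poly (p c) (r\<^sup>2) / sqrt (c - r\<^sup>2))"
    using assms unfolding sqrt_class_def by blast
  have coeff: "coeff (smult k B + pCons 0 (smult l B)) i = 0"
    if "\<forall>i\<ge>n. coeff B i = 0" "i \<ge> Suc n" for B :: "real poly" and i n
    using that by (cases i) auto
  show ?thesis
    unfolding sqrt_class_def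
  proof (intro exI[of _ "smult k A + pCons 0 (smult l A)"] exI[of _ "\<lambda>c. smult k (p c) + pCons 0 (smult l (p c))"] conjI)
    show "\<forall>r\<in>{0<..<\<rho>}. (k + l * r\<^sup>2) * f r = poly (smult k A + pCons 0 (smult l A)) (r\<^sup>2) +
        (\<Sum>c\<in>C. poly (smult k (p c) + pCons 0 (smult l (p c))) (r\<^sup>2) / sqrt (c - r\<^sup>2))"
      using Ap(3) by (simp add: algebra_simps add_divide_distrib sum.distrib sum_distrib_left)
    show "\<forall>i\<ge>Suc N. coeff (smult k A + pCons 0 (smult l A)) i = 0"
      using coeff[OF Ap(1)] by blast
    show "\<forall>c. \<forall>i\<ge>Suc M. coeff (smult k (p c) + pCons 0 (smult l (p c))) i = 0"
      using coeff[of M "p _"] Ap(2) by blast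
  qed
qed

lemma sqrt_class_cmult:
  assumes "sqrt_class C \<rho> N M f"
  shows "sqrt_class C \<rho> N M (\<lambda>r. k * f r)"
proof -
  obtain A p where Ap: "\<forall>i\<ge>N. coeff A i = 0" "\<forall>c. \<forall>i\<ge>M. coeff (p c) i = 0"
    "\<forall>r\<in>{0<..<\<rho>}. f r = poly A (r\<^sup>2) + (\<Sum>c\<in>C. poly (p c) (r\<^sup>2) / sqrt (c - r\<^sup>2))"
    using assms unfolding sqrt_class_def by blast
  then show ?thesis
    unfolding sqrt_class_def
    by (intro exI[of _ "smult k A"] exI[of _ "\<lambda>c. smult k (p c)"])
      (auto simp: algebra_simps sum_distrib_left)
qed

lemma sqrt_class_sum:
  "(\<And>i. i \<in> I \<Longrightarrow> sqrt_class C \<rho> N M (f i)) \<Longrightarrow> sqrt_class C \<rho> N M (\<lambda>r. \<Sum>i\<in>I. f i r)"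
proof (induction I rule: infinite_finite_induct)
  case (insert i I)
  then show ?case by (simp add: sqrt_class_add)
qed (use sqrt_class_poly[of N 0 C \<rho> M] in auto)

lemma sqrt_class_prod_mult:
  assumes "finite L" "sqrt_class C \<rho> N M f"
  shows "sqrt_class C \<rho> (N + card L) (M + card L) (\<lambda>r. (\<Prod>l\<in>L. l - r\<^sup>2) * f r)"
  using assms(1)
proof (induction L rule: finite_induct)
  case empty
  then show ?case using assms(2) by simp
next
  case (insert x L)
  from sqrt_class_affine_mult[OF insert.IH, of x "-1"] insert.hyps show ?case
    by (simp add: mult.assoc)
qed

lemma sqrt_class_recip_sqrt:
  assumes "finite C" "a\<^sup>2 \<in> C"
  shows "sqrt_class C \<rho> 0 1 (\<lambda>r. k / sqrt (a\<^sup>2 - r\<^sup>2))"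
proof -
  have "k / sqrt (a\<^sup>2 - r\<^sup>2) = (\<Sum>c\<in>C. poly (if c = a\<^sup>2 then [:k:] else 0) (r\<^sup>2) / sqrt (c - r\<^sup>2))" for r
  proof -
    have "(\<Sum>c\<in>C. poly (if c = a\<^sup>2 then [:k:] else 0) (r\<^sup>2) / sqrt (c - r\<^sup>2))
        = (\<Sum>c\<in>C. if c = a\<^sup>2 then k / sqrt (a\<^sup>2 - r\<^sup>2) else 0)"
      by (intro sum.cong) auto
    then show ?thesis using assms by simp
  qed
  then show ?thesis
    unfolding sqrt_class_def
    by (intro exI[of _ 0] exI[of _ "\<lambda>c. if c = a\<^sup>2 then [:k:] else 0"])
      (auto simp: coeff_pCons split: nat.splits)
qed

lemma circ_cont_basic:
  "circ_cont (\<lambda>x y. k) r" "circ_cont (\<lambda>x y. x) r" "circ_cont (\<lambda>x y. y) r"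
  by (auto simp: circ_cont_def intro!: continuous_intros)

lemma circ_cont_arith:
  "circ_cont u r \<Longrightarrow> circ_cont v r \<Longrightarrow> circ_cont (\<lambda>x y. u x y + v x y) r"
  "circ_cont u r \<Longrightarrow> circ_cont v r \<Longrightarrow> circ_cont (\<lambda>x y. u x y * v x y) r"
  "circ_cont u r \<Longrightarrow> circ_cont (\<lambda>x y. u x y ^ n) r"
  "(\<And>i. i \<in> A \<Longrightarrow> circ_cont (w i) r) \<Longrightarrow> circ_cont (\<lambda>x y. \<Sum>i\<in>A. w i x y) r"
  by (auto simp: circ_cont_def intro!: continuous_intros)

lemma circ_cont_divide:
  assumes "circ_cont u r" "0 < r" "r < \<bar>a\<bar>"
  shows "circ_cont (\<lambda>x y. u x y / (x - a)) r" "circ_cont (\<lambda>x y. u x y / (y - a)) r"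
proof -
  have bound: "\<bar>r * cos t\<bar> \<le> r" "\<bar>r * sin t\<bar> \<le> r" for t
    using assms(2) abs_cos_le_one[of t] abs_sin_le_one[of t] by (auto simp: abs_mult intro: mult_left_le)
  have "r * cos t - a \<noteq> 0" "r * sin t - a \<noteq> 0" for t
    using assms(3) bound[of t] by auto
  with assms(1) show "circ_cont (\<lambda>x y. u x y / (x - a)) r" "circ_cont (\<lambda>x y. u x y / (y - a)) r"
    by (auto simp: circ_cont_def intro!: continuous_intros)
qed

lemmas circ_cont_intros = circ_cont_basic circ_cont_arith circ_cont_divide

lemma sqrt_class_monomial: "sqrt_class C \<rho> ((i + j) div 2 + 1) M (circ_int (\<lambda>x y. x ^ i * y ^ j))"
proof (cases "even i \<and> even j")
  case False
  have "circ_int (\<lambda>x y. x ^ i * y ^ j) r = 0" for r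
  proof -
    have cont: "circ_cont (\<lambda>x y. x ^ i * y ^ j) r" by (intro circ_cont_intros)
    have "circ_int (\<lambda>x y. (-1) * (x ^ i * y ^ j)) r = circ_int (\<lambda>x y. x ^ i * y ^ j) r"
      using False circ_int_symmetries(1,2)[OF cont] by auto
    then show ?thesis by (simp only: circ_int_cmult)
  qed
  then show ?thesis
    by (intro sqrt_class_cong[OF _ sqrt_class_poly[of _ 0]]) auto
next
  case True
  define k where "k = circ_int (\<lambda>x y. x ^ i * y ^ j) 1"
  have "circ_int (\<lambda>x y. x ^ i * y ^ j) r = poly (monom k ((i + j) div 2)) (r\<^sup>2)" for r
  proof -
    have "even (i + j)" using True by simp
    then have "r ^ (i + j) = (r\<^sup>2) ^ ((i + j) div 2)" by (simp flip: power_mult)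
    moreover have "circ_int (\<lambda>x y. x ^ i * y ^ j) r = r ^ (i + j) * k"
      unfolding circ_int_def k_def
      by (simp add: power_mult_distrib power_add mult_ac flip: integral_mult_right)
    ultimately show ?thesis by (simp add: poly_monom)
  qed
  then show ?thesis
    by (intro sqrt_class_cong[OF _ sqrt_class_poly[of _ "monom k ((i + j) div 2)"]]) auto
qed

lemma sqrt_class_monomial_over_linear:
  assumes C: "finite C" "a\<^sup>2 \<in> C" and \<rho>: "\<rho> \<le> \<bar>a\<bar>"
  shows "sqrt_class C \<rho> ((i + j + 1) div 2) (j div 2 + 1) (circ_int (\<lambda>x y. x ^ i * y ^ j / (x - a)))"
proof -
  have step: "circ_int (\<lambda>x y. x ^ Suc i * y ^ j / (x - a)) r =
      circ_int (\<lambda>x y. x ^ i * y ^ j) r + a * circ_int (\<lambda>x y. x ^ i * y ^ j / (x - a)) r"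
    if "0 < r" "r < \<rho>" for i j r
  proof -
    have "circ_int (\<lambda>x y. x ^ Suc i * y ^ j / (x - a)) r =
        circ_int (\<lambda>x y. x ^ i * y ^ j + a * (x ^ i * y ^ j / (x - a))) r"
      by (rule circ_int_cong) (use that \<rho> in \<open>auto simp: field_simps\<close>)
    also have "\<dots> = circ_int (\<lambda>x y. x ^ i * y ^ j) r + circ_int (\<lambda>x y. a * (x ^ i * y ^ j / (x - a))) r"
      using that \<rho> by (intro circ_int_add circ_cont_intros) auto
    finally show ?thesis by (simp only: circ_int_cmult)
  qed
  have base: "sqrt_class C \<rho> ((j + 1) div 2) (j div 2 + 1) (circ_int (\<lambda>x y. x ^ 0 * y ^ j / (x - a)))" for j
  proof (induction j rule: induct_nat_012)
    case 0
    have "sqrt_class C \<rho> 0 1 (\<lambda>r. - (2 * pi * sgn a) / sqrt (a\<^sup>2 - r\<^sup>2))"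
      by (rule sqrt_class_recip_sqrt[OF C])
    then have "sqrt_class C \<rho> 0 1 (circ_int (\<lambda>x y. 1 / (x - a)))"
      by (rule sqrt_class_cong[rotated]) (use \<rho> in \<open>auto simp: circ_int_recip\<close>)
    then show ?case by simp
  next
    case 1
    have "circ_int (\<lambda>x y. y / (x - a)) r = 0" if "0 < r" "r < \<rho>" for r
    proof -
      have "circ_cont (\<lambda>x y. y / (x - a)) r" using that \<rho> by (intro circ_cont_intros) auto
      from circ_int_symmetries(2)[OF this] circ_int_cmult[of "-1" "\<lambda>x y. y / (x - a)" r]
      show ?thesis by simp
    qed
    then show ?case
      by (intro sqrt_class_cong[OF _ sqrt_class_poly[of _ 0]]) auto
  next
    case (ge2 j)
    let ?h = "\<lambda>i j. circ_int (\<lambda>x y. x ^ i * y ^ j / (x - a))"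
    let ?\<mu> = "\<lambda>i j. circ_int (\<lambda>x y. x ^ i * y ^ j)"
    have rec: "?h 0 (Suc (Suc j)) r = (- a\<^sup>2 + 1 * r\<^sup>2) * ?h 0 j r + (-1) * ?\<mu> 1 j r + (- a) * ?\<mu> 0 j r"
      if r: "0 < r" "r < \<rho>" for r
    proof -
      have "?h 0 (Suc (Suc j)) r = circ_int (\<lambda>x y. r\<^sup>2 * (x ^ 0 * y ^ j / (x - a)) + (-1) * (x ^ 2 * y ^ j / (x - a))) r"
      proof (rule circ_int_cong)
        fix x y :: real assume "\<bar>x\<bar> \<le> r" and xy: "x\<^sup>2 + y\<^sup>2 = r\<^sup>2"
        then have "x - a \<noteq> 0" using r \<rho> by auto
        then show "x ^ 0 * y ^ Suc (Suc j) / (x - a) = r\<^sup>2 * (x ^ 0 * y ^ j / (x - a)) + (-1) * (x ^ 2 * y ^ j / (x - a))"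
          unfolding xy[symmetric] by (simp add: algebra_simps add_divide_distrib power2_eq_square)
      qed (use r in simp)
      also have "\<dots> = r\<^sup>2 * ?h 0 j r + (-1) * ?h 2 j r"
        using r \<rho> by (subst circ_int_add) (auto simp only: circ_int_cmult intro!: circ_cont_intros)
      also have "?h 2 j r = ?\<mu> 1 j r + a * (?\<mu> 0 j r + a * ?h 0 j r)"
        using step[OF r, of 1 j] step[OF r, of 0 j] by (simp add: numeral_2_eq_2)
      finally show ?thesis by (simp add: algebra_simps power2_eq_square)
    qed
    have "sqrt_class C \<rho> ((Suc (Suc j) + 1) div 2) (Suc (Suc j) div 2 + 1)
        (\<lambda>r. (- a\<^sup>2 + 1 * r\<^sup>2) * ?h 0 j r + (-1) * ?\<mu> 1 j r + (- a) * ?\<mu> 0 j r)"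
      by (intro sqrt_class_add sqrt_class_cmult
          sqrt_class_mono[OF sqrt_class_affine_mult[OF ge2.IH(1)]]
          sqrt_class_mono[OF sqrt_class_monomial[where M = 0]]) auto
    then show ?case by (rule sqrt_class_cong[rotated]) (simp only: rec)
  qed
  show ?thesis
  proof (induction i)
    case 0
    then show ?case using base[of j] by simp
  next
    case (Suc i)
    have "sqrt_class C \<rho> ((Suc i + j + 1) div 2) (j div 2 + 1)
       (\<lambda>r. circ_int (\<lambda>x y. x ^ i * y ^ j) r + a * circ_int (\<lambda>x y. x ^ i * y ^ j / (x - a)) r)"
      by (intro sqrt_class_add sqrt_class_cmult sqrt_class_mono[OF Suc]
          sqrt_class_mono[OF sqrt_class_monomial[where M = 0]]) auto
    then show ?case by (rule sqrt_class_cong[rotated]) (use step in auto)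
  qed
qed

text \<open>On the circle \<open>(x - a)(x + a) + (y - b)(y + b) = r\<^sup>2 - (a\<^sup>2 + b\<^sup>2)\<close>, which separates the two poles.\<close>

lemma circ_int_recip_mixed:
  assumes r: "0 < r" "r < \<bar>a\<bar>" "r < \<bar>b\<bar>"
  shows "(a\<^sup>2 + b\<^sup>2 - r\<^sup>2) * circ_int (\<lambda>x y. 1 / ((x - a) * (y - b))) r =
    (- a) * circ_int (\<lambda>x y. 1 / (x - b)) r + (- b) * circ_int (\<lambda>x y. 1 / (x - a)) r"
proof -
  have cont: "circ_cont (\<lambda>x y. x / (y - b)) r" "circ_cont (\<lambda>x y. y / (x - a)) r"
    "circ_cont (\<lambda>x y. 1 / (y - b)) r" "circ_cont (\<lambda>x y. 1 / (x - a)) r" "circ_cont (\<lambda>x y. 1 / (x - b)) r"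
    using r by (auto intro!: circ_cont_intros)
  have 0: "circ_int (\<lambda>x y. x / (y - b)) r = 0" "circ_int (\<lambda>x y. y / (x - a)) r = 0"
    using circ_int_symmetries(1)[OF cont(1)] circ_int_cmult[of "-1" "\<lambda>x y. x / (y - b)" r]
      circ_int_symmetries(2)[OF cont(2)] circ_int_cmult[of "-1" "\<lambda>x y. y / (x - a)" r] by auto
  have "(a\<^sup>2 + b\<^sup>2 - r\<^sup>2) * circ_int (\<lambda>x y. 1 / ((x - a) * (y - b))) r =
     circ_int (\<lambda>x y. (a\<^sup>2 + b\<^sup>2 - r\<^sup>2) * (1 / ((x - a) * (y - b)))) r"
    by (simp only: circ_int_cmult)
  also have "\<dots> = circ_int (\<lambda>x y. ((-1) * (x / (y - b)) + (-1) * (y / (x - a))) +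
      ((- a) * (1 / (y - b)) + (- b) * (1 / (x - a)))) r"
  proof (rule circ_int_cong)
    fix x y :: real assume "\<bar>x\<bar> \<le> r" "\<bar>y\<bar> \<le> r" and xy: "x\<^sup>2 + y\<^sup>2 = r\<^sup>2"
    then have "x - a \<noteq> 0" "y - b \<noteq> 0" using r by auto
    then show "(a\<^sup>2 + b\<^sup>2 - r\<^sup>2) * (1 / ((x - a) * (y - b))) =
       ((-1) * (x / (y - b)) + (-1) * (y / (x - a))) + ((- a) * (1 / (y - b)) + (- b) * (1 / (x - a)))"
      unfolding xy[symmetric] by (simp add: divide_simps) (simp add: power2_eq_square algebra_simps)
  qed (use r in simp)
  also have "\<dots> = ((-1) * circ_int (\<lambda>x y. x / (y - b)) r + (-1) * circ_int (\<lambda>x y. y / (x - a)) r) +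
      ((- a) * circ_int (\<lambda>x y. 1 / (y - b)) r + (- b) * circ_int (\<lambda>x y. 1 / (x - a)) r)"
    using cont by (subst circ_int_add circ_int_cmult; (intro circ_cont_intros cont)?)+ (use r in auto)
  also have "circ_int (\<lambda>x y. 1 / (y - b)) r = circ_int (\<lambda>x y. 1 / (x - b)) r"
    using circ_int_symmetries(3)[OF cont(5)] .
  finally show ?thesis by (simp only: 0)
qed

lemma sqrt_class_monomial_over_bilinear:
  assumes C: "finite C" "a\<^sup>2 \<in> C" "b\<^sup>2 \<in> C" and \<rho>: "\<rho> \<le> \<bar>a\<bar>" "\<rho> \<le> \<bar>b\<bar>"
    and L: "finite L" "a\<^sup>2 + b\<^sup>2 \<in> L" and ij: "i + j \<le> n + 1"
  shows "sqrt_class C \<rho> ((n + 1) div 2 + card L) (n div 2 + 1 + card L)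
    (\<lambda>r. (\<Prod>l\<in>L. l - r\<^sup>2) * circ_int (\<lambda>x y. x ^ i * y ^ j / ((x - a) * (y - b))) r)"
proof -
  let ?\<Lambda> = "\<lambda>r. \<Prod>l\<in>L. l - r\<^sup>2"
  let ?H = "\<lambda>i j. circ_int (\<lambda>x y. x ^ i * y ^ j / ((x - a) * (y - b)))"
  let ?P = "sqrt_class C \<rho> ((n + 1) div 2 + card L) (n div 2 + 1 + card L)"
  have cont: "circ_cont (\<lambda>x y. x ^ i * y ^ j / (x - a)) r" "circ_cont (\<lambda>x y. x ^ i * y ^ j / (y - b)) r"
    "circ_cont (\<lambda>x y. x ^ i * y ^ j / ((x - a) * (y - b))) r" "circ_cont (\<lambda>x y. x ^ i * y ^ j / (x - b)) r"
    if "0 < r" "r < \<rho>" for r i j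
    unfolding divide_divide_eq_left[symmetric] using that \<rho> by - ((intro circ_cont_intros; simp)+)
  have x_step: "?H (Suc i) j r = circ_int (\<lambda>x y. x ^ j * y ^ i / (x - b)) r + a * ?H i j r"
    if r: "0 < r" "r < \<rho>" for i j r
  proof -
    have "?H (Suc i) j r = circ_int (\<lambda>x y. x ^ i * y ^ j / (y - b) + a * (x ^ i * y ^ j / ((x - a) * (y - b)))) r"
    proof (rule circ_int_cong)
      fix x y :: real assume "\<bar>x\<bar> \<le> r" "\<bar>y\<bar> \<le> r"
      then have "x - a \<noteq> 0" "y - b \<noteq> 0" using r \<rho> by auto
      then show "x ^ Suc i * y ^ j / ((x - a) * (y - b)) =
          x ^ i * y ^ j / (y - b) + a * (x ^ i * y ^ j / ((x - a) * (y - b)))"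
        by (simp add: divide_simps) (simp add: algebra_simps)
    qed (use r in simp)
    also have "\<dots> = circ_int (\<lambda>x y. x ^ i * y ^ j / (y - b)) r + circ_int (\<lambda>x y. a * (x ^ i * y ^ j / ((x - a) * (y - b)))) r"
      using r by (intro circ_int_add circ_cont_arith(2) circ_cont_basic cont)
    also have "circ_int (\<lambda>x y. x ^ i * y ^ j / (y - b)) r = circ_int (\<lambda>x y. x ^ j * y ^ i / (x - b)) r"
      using circ_int_symmetries(3)[OF cont(4)[OF r, of j i]] by (simp add: mult.commute)
    finally show ?thesis by (simp only: circ_int_cmult)
  qed
  have y_step: "?H 0 (Suc j) r = circ_int (\<lambda>x y. x ^ 0 * y ^ j / (x - a)) r + b * ?H 0 j r"
    if r: "0 < r" "r < \<rho>" for j r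
  proof -
    have "?H 0 (Suc j) r = circ_int (\<lambda>x y. x ^ 0 * y ^ j / (x - a) + b * (x ^ 0 * y ^ j / ((x - a) * (y - b)))) r"
    proof (rule circ_int_cong)
      fix x y :: real assume "\<bar>x\<bar> \<le> r" "\<bar>y\<bar> \<le> r"
      then have "x - a \<noteq> 0" "y - b \<noteq> 0" using r \<rho> by auto
      then show "x ^ 0 * y ^ Suc j / ((x - a) * (y - b)) =
          x ^ 0 * y ^ j / (x - a) + b * (x ^ 0 * y ^ j / ((x - a) * (y - b)))"
        by (simp add: divide_simps) (simp add: algebra_simps)
    qed (use r in simp)
    also have "\<dots> = circ_int (\<lambda>x y. x ^ 0 * y ^ j / (x - a)) r + circ_int (\<lambda>x y. b * (x ^ 0 * y ^ j / ((x - a) * (y - b)))) r"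
      using r by (intro circ_int_add circ_cont_arith(2) circ_cont_basic cont)
    finally show ?thesis by (simp only: circ_int_cmult)
  qed
  have pole: "?P (\<lambda>r. ?\<Lambda> r * circ_int (\<lambda>x y. x ^ i * y ^ j / (x - c)) r)"
    if "c\<^sup>2 \<in> C" "\<rho> \<le> \<bar>c\<bar>" "i + j \<le> n" for c i j
  proof -
    have "sqrt_class C \<rho> ((n + 1) div 2) (n div 2 + 1) (circ_int (\<lambda>x y. x ^ i * y ^ j / (x - c)))"
      by (rule sqrt_class_mono[OF sqrt_class_monomial_over_linear[OF C(1) that(1,2)]])
        (use that in \<open>auto intro!: div_le_mono\<close>)
    from sqrt_class_prod_mult[OF L(1) this] show ?thesis by simp
  qed
  have corner: "?P (\<lambda>r. ?\<Lambda> r * ?H 0 0 r)"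
  proof -
    let ?g = "\<lambda>r. (- a) * circ_int (\<lambda>x y. x ^ 0 * y ^ 0 / (x - b)) r + (- b) * circ_int (\<lambda>x y. x ^ 0 * y ^ 0 / (x - a)) r"
    have "sqrt_class C \<rho> 0 1 ?g"
      using sqrt_class_monomial_over_linear[OF C(1,2) \<rho>(1), of 0 0]
        sqrt_class_monomial_over_linear[OF C(1,3) \<rho>(2), of 0 0]
      by (intro sqrt_class_add sqrt_class_cmult) auto
    from sqrt_class_prod_mult[OF _ this, of "L - {a\<^sup>2 + b\<^sup>2}"] L(1)
    have "sqrt_class C \<rho> (0 + card (L - {a\<^sup>2 + b\<^sup>2})) (1 + card (L - {a\<^sup>2 + b\<^sup>2}))
        (\<lambda>r. (\<Prod>l\<in>L - {a\<^sup>2 + b\<^sup>2}. l - r\<^sup>2) * ?g r)" by blast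
    then have "?P (\<lambda>r. (\<Prod>l\<in>L - {a\<^sup>2 + b\<^sup>2}. l - r\<^sup>2) * ?g r)"
      by (rule sqrt_class_mono) (use L card_mono[OF L(1), of "L - {a\<^sup>2 + b\<^sup>2}"] in auto)
    then show ?thesis
    proof (rule sqrt_class_cong[rotated])
      fix r assume "0 < r" "r < \<rho>"
      then have "(a\<^sup>2 + b\<^sup>2 - r\<^sup>2) * ?H 0 0 r = ?g r"
        using circ_int_recip_mixed[of r a b] \<rho> by simp
      from this[symmetric] show "(\<Prod>l\<in>L - {a\<^sup>2 + b\<^sup>2}. l - r\<^sup>2) * ?g r = ?\<Lambda> r * ?H 0 0 r"
        unfolding prod.remove[OF L] by (simp only: mult_ac)
    qed
  qed
  have y: "?P (\<lambda>r. ?\<Lambda> r * ?H 0 j r)" if "j \<le> n + 1" for j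
    using that
  proof (induction j)
    case (Suc j)
    then have "?P (\<lambda>r. ?\<Lambda> r * circ_int (\<lambda>x y. x ^ 0 * y ^ j / (x - a)) r + b * (?\<Lambda> r * ?H 0 j r))"
      using C \<rho> by (intro sqrt_class_add sqrt_class_cmult pole) auto
    then show ?case
      by (rule sqrt_class_cong[rotated]) (simp only: y_step distrib_left mult.left_commute)
  qed (rule corner)
  show ?thesis
    using ij
  proof (induction i)
    case (Suc i)
    then have "?P (\<lambda>r. ?\<Lambda> r * circ_int (\<lambda>x y. x ^ j * y ^ i / (x - b)) r + a * (?\<Lambda> r * ?H i j r))"
      using C \<rho> by (intro sqrt_class_add sqrt_class_cmult pole) auto
    then show ?case
      by (rule sqrt_class_cong[rotated]) (simp only: x_step distrib_left mult.left_commute)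
  qed (use y in simp)
qed

lemma partial_fractions:
  fixes a :: "nat \<Rightarrow> real"
  assumes "finite J" "J \<noteq> {}" "inj_on a J"
  shows "\<exists>w. \<forall>x. (\<forall>j\<in>J. x \<noteq> a j) \<longrightarrow> 1 / (\<Prod>j\<in>J. x - a j) = (\<Sum>j\<in>J. w j / (x - a j))"
  using assms
proof (induction J rule: finite_ne_induct)
  case (singleton j)
  show ?case by (rule exI[of _ "\<lambda>_. 1"]) simp
next
  case (insert k J)
  then obtain w where w: "\<And>x. \<forall>j\<in>J. x \<noteq> a j \<Longrightarrow> 1 / (\<Prod>j\<in>J. x - a j) = (\<Sum>j\<in>J. w j / (x - a j))"
    by auto
  define v where "v j = (if j = k then - (\<Sum>j\<in>J. w j / (a j - a k)) else w j / (a j - a k))" for j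
  have "1 / (\<Prod>j\<in>insert k J. x - a j) = (\<Sum>j\<in>insert k J. v j / (x - a j))"
    if x: "\<forall>j\<in>insert k J. x \<noteq> a j" for x
  proof -
    have "1 / (\<Prod>j\<in>insert k J. x - a j) = (\<Sum>j\<in>J. w j / (x - a j)) / (x - a k)"
      using insert.hyps x w[of x] by (simp add: divide_divide_eq_left' flip: divide_divide_eq_left)
    also have "\<dots> = (\<Sum>j\<in>J. w j / (a j - a k) / (x - a j) - w j / (a j - a k) / (x - a k))"
      unfolding sum_divide_distrib
    proof (rule sum.cong[OF refl])
      fix j assume "j \<in> J"
      moreover have "a j \<noteq> a k" using insert.prems insert.hyps \<open>j \<in> J\<close> by (metis inj_onD insertCI)
      ultimately show "w j / (x - a j) / (x - a k) = w j / (a j - a k) / (x - a j) - w j / (a j - a k) / (x - a k)"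
        using x by (simp add: divide_simps) (simp add: algebra_simps)
    qed
    also have "\<dots> = (\<Sum>j\<in>J. v j / (x - a j)) + v k / (x - a k)"
    proof -
      have "(\<Sum>j\<in>J. w j / (a j - a k) / (x - a j)) = (\<Sum>j\<in>J. v j / (x - a j))"
        using insert.hyps by (intro sum.cong) (auto simp: v_def)
      then show ?thesis by (simp add: sum_subtractf sum_divide_distrib v_def)
    qed
    finally show ?thesis using insert.hyps by simp
  qed
  then show ?case by blast
qed

subsection \<open>The Abelian integral\<close>

lemma zeros_le_reindex:
  assumes f: "zeros_le V f N" and g: "inj_on g U" "g ` U \<subseteq> V"
    and "\<And>x m. x \<in> U \<Longrightarrow> vanishes m h x \<Longrightarrow> vanishes m f (g x)"
  shows "zeros_le U h N"
  unfolding zeros_le_def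
proof (intro allI impI)
  fix S and m :: "real \<Rightarrow> nat"
  assume S: "finite S" "S \<subseteq> U" "\<forall>x\<in>S. vanishes (m x) h x"
  define m' where "m' = m \<circ> inv_into U g"
  have inv: "inv_into U g (g x) = x" if "x \<in> S" for x using that S g by (auto intro: inv_into_f_f)
  have "finite (g ` S)" "g ` S \<subseteq> V" "\<forall>y\<in>g ` S. vanishes (m' y) f y"
    using S g assms(4) by (auto simp: m'_def inv)
  then have "sum m' (g ` S) \<le> N" using f unfolding zeros_le_def by blast
  also have "sum m' (g ` S) = sum m S"
    using S g by (subst sum.reindex) (auto simp: m'_def inv intro: inj_on_subset)
  finally show "sum m S \<le> N" .
qed

lemma zeros_le_zero_mult:
  assumes "zeros_le U f N"
  shows "finite {r\<in>U. f r = 0}" "\<forall>r\<in>U. \<exists>k. (deriv ^^ k) f r \<noteq> 0"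
    "(\<Sum>r\<in>{r\<in>U. f r = 0}. zero_mult f r) \<le> N"
proof -
  show fin: "finite {r\<in>U. f r = 0}" by (rule zeros_le_finite(1)[OF assms])
  show "\<forall>r\<in>U. \<exists>k. (deriv ^^ k) f r \<noteq> 0"
  proof (rule ballI, rule ccontr)
    fix r assume r: "r \<in> U" "\<not> (\<exists>k. (deriv ^^ k) f r \<noteq> 0)"
    then show False
      using assms[unfolded zeros_le_def, rule_format, of "{r}" "\<lambda>_. Suc N"] by (auto simp: vanishes_def)
  qed
  have "vanishes (zero_mult f r) f r" for r
    unfolding vanishes_def zero_mult_def using not_less_Least by blast
  with fin show "(\<Sum>r\<in>{r\<in>U. f r = 0}. zero_mult f r) \<le> N"
    using assms unfolding zeros_le_def by blast
qed

lemma sqrt_class_zeros_le: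
  assumes C: "finite C" "\<And>c. c \<in> C \<Longrightarrow> \<rho>\<^sup>2 \<le> c" and L: "finite L" "\<And>l. l \<in> L \<Longrightarrow> \<rho>\<^sup>2 \<le> l"
    and f: "sqrt_class C \<rho> N M (\<lambda>r. (\<Prod>l\<in>L. l - r\<^sup>2) * f r)" and NM: "M \<le> N + 1"
    and r0: "0 < r0" "r0 < \<rho>" "f r0 \<noteq> 0"
  shows "zeros_le {0<..<\<rho>} f (card C * M + N - 1)"
proof -
  let ?U = "{0<..<\<rho>}" and ?V = "{0<..<\<rho>\<^sup>2}"
  define \<Lambda> where "\<Lambda> r = (\<Prod>l\<in>L. l - r\<^sup>2)" for r
  obtain A p where Ap: "\<forall>i\<ge>N. coeff A i = 0" "\<forall>c. \<forall>i\<ge>M. coeff (p c) i = 0"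
    and eq: "\<forall>r\<in>?U. \<Lambda> r * f r = poly A (r\<^sup>2) + (\<Sum>c\<in>C. poly (p c) (r\<^sup>2) / sqrt (c - r\<^sup>2))"
    using f unfolding sqrt_class_def \<Lambda>_def by blast
  have less: "r\<^sup>2 < \<rho>\<^sup>2" if "r \<in> ?U" for r
    using that by (intro power_strict_mono) auto
  have \<Lambda>: "\<Lambda> r > 0" if "r \<in> ?U" for r
    unfolding \<Lambda>_def using less[OF that] L(2) by (intro prod_pos) force
  define J where "J s = poly A s + (\<Sum>c\<in>C. poly (p c) s * (c + (-1) * s) powr (-(1/2)))" for s
  have J: "J s = poly A s + (\<Sum>c\<in>C. poly (p c) s / sqrt (c - s))" if "s < \<rho>\<^sup>2" for s
  proof -
    have "(c + (-1) * s) powr (-(1/2)) = 1 / sqrt (c - s)" if "c \<in> C" for c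
    proof -
      have "c - s > 0" using C(2)[OF that] \<open>s < \<rho>\<^sup>2\<close> by simp
      then show ?thesis by (simp add: powr_minus_divide powr_half_sqrt)
    qed
    then show ?thesis by (simp only: J_def times_divide_eq_right mult_1_right cong: sum.cong)
  qed
  have JC: "ndiff m {..<\<rho>\<^sup>2} J" for m
    unfolding J_def[abs_def]
  proof (intro ndiff_add ndiff_sum ndiff_mult ndiff_poly open_lessThan)
    fix c assume c: "c \<in> C"
    have "ndiff m {..<\<rho>\<^sup>2} (\<lambda>s. c + (-1) * s)" by (intro ndiff_add ndiff_mult) auto
    then show "ndiff m {..<\<rho>\<^sup>2} (\<lambda>s. (c + (-1) * s) powr (-(1/2)))"
      by (rule ndiff_compose[where V = "{0<..}", rotated 4, OF _ open_lessThan open_greaterThan _ ndiff_powr])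
        (use C(2)[OF c] in auto)
  qed
  have Jf: "J (r\<^sup>2) = f r * \<Lambda> r" if "r \<in> ?U" for r
    using eq that J[OF less[OF that]] by (simp add: mult.commute)
  have sqC: "ndiff m ?U (\<lambda>r. r\<^sup>2)" for m
    unfolding power2_eq_square by (intro ndiff_mult) auto
  have \<Lambda>C: "ndiff m ?U \<Lambda>" for m
  proof -
    have "ndiff m ?U (\<lambda>r. \<Prod>l\<in>L. l + (-1) * r\<^sup>2)"
      by (intro ndiff_prod ndiff_add ndiff_mult sqC) auto
    then show ?thesis by (simp add: \<Lambda>_def[abs_def])
  qed
  have JsqC: "ndiff m ?U (\<lambda>r. J (r\<^sup>2))" for m
    by (rule ndiff_compose[OF _ _ _ JC sqC]) (use less in auto)
  have fC: "ndiff m ?U f" for m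
  proof -
    have "ndiff m ?U (\<lambda>r. \<Lambda> r powr (-1))"
      by (rule ndiff_compose[where V = "{0<..}", rotated 4, OF \<Lambda>C _ open_greaterThan _ ndiff_powr])
        (use \<Lambda> in auto)
    with JsqC have "ndiff m ?U (\<lambda>r. J (r\<^sup>2) * \<Lambda> r powr (-1))" by (intro ndiff_mult) auto
    moreover have "J (r\<^sup>2) * \<Lambda> r powr (-1) = f r" if "r \<in> ?U" for r
      using \<Lambda>[OF that] Jf[OF that] by (simp add: powr_minus)
    ultimately show ?thesis
      using ndiff_cong_open[of ?U "\<lambda>r. J (r\<^sup>2) * \<Lambda> r powr (-1)" f m] by simp
  qed
  have "J (r0\<^sup>2) \<noteq> 0" using Jf[of r0] \<Lambda>[of r0] r0 by simp
  then have "zeros_le {..<\<rho>\<^sup>2} J (card C * M + N - 1)"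
    using Ap NM less[of r0] r0
    by (intro poly_sqrt_combination_zeros_le[OF C _ _ NM J, where ?s0.0 = "r0\<^sup>2"]) auto
  then show ?thesis
  proof (rule zeros_le_reindex[where g = "\<lambda>r. r\<^sup>2"])
    show "inj_on (\<lambda>r. r\<^sup>2) ?U"
      by (intro inj_onI) (use power2_eq_iff_nonneg in force)
    show "(\<lambda>r. r\<^sup>2) ` ?U \<subseteq> {..<\<rho>\<^sup>2}" using less by auto
    fix r m assume r: "r \<in> ?U" and v: "vanishes m f r"
    have "vanishes m (\<lambda>r. f r * \<Lambda> r) r"
      by (rule vanishes_mult[OF _ r fC \<Lambda>C v]) auto
    then have vJ: "vanishes m (\<lambda>r. J (r\<^sup>2)) r"
      using vanishes_cong_open[of ?U r "\<lambda>r. f r * \<Lambda> r" "\<lambda>r. J (r\<^sup>2)" m] r Jf by simp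
    have root: "s powr (1/2) \<in> ?U" "(s powr (1/2))\<^sup>2 = s" if "s \<in> ?V" for s
    proof -
      have "sqrt s < \<rho>" using that r by (intro real_less_lsqrt) auto
      then show "s powr (1/2) \<in> ?U" "(s powr (1/2))\<^sup>2 = s" using that by (auto simp: powr_half_sqrt)
    qed
    have "(r\<^sup>2) powr (1/2) = r" using r by (simp add: powr_half_sqrt)
    have "vanishes m (\<lambda>s. J ((s powr (1/2))\<^sup>2)) (r\<^sup>2)"
    proof (rule vanishes_compose[where U = ?V and V = ?U and g = "\<lambda>s. s powr (1/2)"])
      show "ndiff m ?V (\<lambda>s. s powr (1/2))" by (rule ndiff_subset[OF ndiff_powr]) auto
      show "vanishes m (\<lambda>r. J (r\<^sup>2)) ((r\<^sup>2) powr (1/2))" unfolding \<open>(r\<^sup>2) powr (1/2) = r\<close> by (rule vJ)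
    qed (use root less[OF r] r JsqC in auto)
    then show "vanishes m J (r\<^sup>2)"
      using vanishes_cong_open[of ?V "r\<^sup>2" "\<lambda>s. J ((s powr (1/2))\<^sup>2)" J m] root less[OF r] r by simp
  qed
qed

lemma finite_degree_set: "finite {(i, j). i + j \<le> (n::nat)}"
  by (rule finite_subset[of _ "{..n} \<times> {..n}"]) auto

lemma abelian_int_sqrt_class:
  assumes g: "\<And>r x y. 0 < r \<Longrightarrow> r < \<rho> \<Longrightarrow> \<bar>x\<bar> \<le> r \<Longrightarrow> \<bar>y\<bar> \<le> r \<Longrightarrow> 1 / G x y = (\<Sum>k\<in>K. w k * g k x y)"
    and K: "finite K" and cont: "\<And>r k. 0 < r \<Longrightarrow> r < \<rho> \<Longrightarrow> k \<in> K \<Longrightarrow> circ_cont (g k) r"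
    and cls: "\<And>i j k. i + j \<le> n + 1 \<Longrightarrow> k \<in> K \<Longrightarrow> sqrt_class C \<rho> N M (\<lambda>r. \<Lambda> r * circ_int (\<lambda>x y. x ^ i * y ^ j * g k x y) r)"
  shows "sqrt_class C \<rho> N M (\<lambda>r. \<Lambda> r * abelian_int (poly2 p n) (poly2 q n) G r)"
proof -
  let ?D = "{(i, j). i + j \<le> n}"
  let ?m = "\<lambda>r i j k. circ_int (\<lambda>x y. x ^ i * y ^ j * g k x y) r"
  have expand: "abelian_int (poly2 p n) (poly2 q n) G r =
      (\<Sum>(z, k)\<in>?D \<times> K. - (q (fst z) (snd z) * w k) * ?m r (fst z) (Suc (snd z)) k
         + - (p (fst z) (snd z) * w k) * ?m r (Suc (fst z)) (snd z) k)"
    if r: "0 < r" "r < \<rho>" for r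
  proof -
    let ?t = "\<lambda>z k x y. - (q (fst z) (snd z) * w k) * (x ^ fst z * y ^ Suc (snd z) * g k x y)
         + - (p (fst z) (snd z) * w k) * (x ^ Suc (fst z) * y ^ snd z * g k x y)"
    have "abelian_int (poly2 p n) (poly2 q n) G r = circ_int (\<lambda>x y. (- y * poly2 q n x y - x * poly2 p n x y) * (1 / G x y)) r"
      unfolding abelian_int_def circ_int_def by (simp add: mult_ac)
    also have "\<dots> = circ_int (\<lambda>x y. \<Sum>zk\<in>?D \<times> K. ?t (fst zk) (snd zk) x y) r"
    proof (rule circ_int_cong)
      fix x y :: real assume xy: "\<bar>x\<bar> \<le> r" "\<bar>y\<bar> \<le> r"
      have "- y * poly2 q n x y - x * poly2 p n x y =
          (\<Sum>z\<in>?D. - y * (q (fst z) (snd z) * x ^ fst z * y ^ snd z) - x * (p (fst z) (snd z) * x ^ fst z * y ^ snd z))"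
        unfolding poly2_def sum_distrib_left sum_subtractf by (simp add: case_prod_beta)
      then show "(- y * poly2 q n x y - x * poly2 p n x y) * (1 / G x y) = (\<Sum>zk\<in>?D \<times> K. ?t (fst zk) (snd zk) x y)"
        unfolding g[OF r xy] sum.cartesian_product'
        by (simp only: sum_product fst_conv snd_conv) (intro sum.cong refl, simp add: algebra_simps)
    qed (use r in simp)
    also have "\<dots> = (\<Sum>zk\<in>?D \<times> K. circ_int (\<lambda>x y. ?t (fst zk) (snd zk) x y) r)"
    proof (rule circ_int_sum)
      show "finite (?D \<times> K)" using K finite_degree_set by simp
      fix zk assume "zk \<in> ?D \<times> K"
      then have "snd zk \<in> K" by auto
      then show "circ_cont (?t (fst zk) (snd zk)) r"
        by (intro circ_cont_arith circ_cont_basic cont[OF r])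
    qed
    also have "\<dots> = (\<Sum>zk\<in>?D \<times> K. - (q (fst (fst zk)) (snd (fst zk)) * w (snd zk)) * ?m r (fst (fst zk)) (Suc (snd (fst zk))) (snd zk)
         + - (p (fst (fst zk)) (snd (fst zk)) * w (snd zk)) * ?m r (Suc (fst (fst zk))) (snd (fst zk)) (snd zk))"
    proof (rule sum.cong[OF refl])
      fix zk assume "zk \<in> ?D \<times> K"
      then have "snd zk \<in> K" by auto
      from cont[OF r this] have "circ_cont (\<lambda>x y. c * (x ^ i * y ^ j * g (snd zk) x y)) r" for c i j
        by (intro circ_cont_arith circ_cont_basic)
      then show "circ_int (\<lambda>x y. ?t (fst zk) (snd zk) x y) r = - (q (fst (fst zk)) (snd (fst zk)) * w (snd zk)) * ?m r (fst (fst zk)) (Suc (snd (fst zk))) (snd zk)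
         + - (p (fst (fst zk)) (snd (fst zk)) * w (snd zk)) * ?m r (Suc (fst (fst zk))) (snd (fst zk)) (snd zk)"
        by (simp only: circ_int_add circ_int_cmult)
    qed
    finally show ?thesis by (simp only: case_prod_unfold)
  qed
  have "sqrt_class C \<rho> N M (\<lambda>r. \<Sum>(z, k)\<in>?D \<times> K. - (q (fst z) (snd z) * w k) * (\<Lambda> r * ?m r (fst z) (Suc (snd z)) k)
         + - (p (fst z) (snd z) * w k) * (\<Lambda> r * ?m r (Suc (fst z)) (snd z) k))"
    unfolding case_prod_unfold
    by (intro sqrt_class_sum sqrt_class_add sqrt_class_cmult cls) auto
  then show ?thesis
    by (rule sqrt_class_cong[rotated])
      (simp only: expand sum_distrib_left case_prod_unfold distrib_left mult.left_commute)
qed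

lemma Gfun_partial_fractions:
  assumes "K1 \<ge> 1" "K2 \<ge> 1" "inj_on a {1..K1}" "inj_on b {1..K2}"
  shows "\<exists>w. \<forall>x y. (\<forall>j\<in>{1..K1}. x \<noteq> a j) \<longrightarrow> (\<forall>l\<in>{1..K2}. y \<noteq> b l) \<longrightarrow>
    1 / Gfun K1 K2 a b x y = (\<Sum>k\<in>{1..K1}\<times>{1..K2}. w k * (1 / ((x - a (fst k)) * (y - b (snd k)))))"
proof -
  obtain u where u: "\<forall>x. (\<forall>j\<in>{1..K1}. x \<noteq> a j) \<longrightarrow> 1 / (\<Prod>j\<in>{1..K1}. x - a j) = (\<Sum>j\<in>{1..K1}. u j / (x - a j))"
    using partial_fractions[of "{1..K1}" a] assms by auto
  obtain v where v: "\<forall>y. (\<forall>l\<in>{1..K2}. y \<noteq> b l) \<longrightarrow> 1 / (\<Prod>l\<in>{1..K2}. y - b l) = (\<Sum>l\<in>{1..K2}. v l / (y - b l))"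
    using partial_fractions[of "{1..K2}" b] assms by auto
  show ?thesis
  proof (intro exI[of _ "\<lambda>k. u (fst k) * v (snd k)"] allI impI)
    fix x y assume "\<forall>j\<in>{1..K1}. x \<noteq> a j" "\<forall>l\<in>{1..K2}. y \<noteq> b l"
    moreover have "1 / Gfun K1 K2 a b x y = (1 / (\<Prod>j\<in>{1..K1}. x - a j)) * (1 / (\<Prod>l\<in>{1..K2}. y - b l))"
      by (simp add: Gfun_def)
    ultimately have "1 / Gfun K1 K2 a b x y = (\<Sum>j\<in>{1..K1}. u j / (x - a j)) * (\<Sum>l\<in>{1..K2}. v l / (y - b l))"
      using u v by (simp only:)
    then show "1 / Gfun K1 K2 a b x y =
        (\<Sum>k\<in>{1..K1}\<times>{1..K2}. u (fst k) * v (snd k) * (1 / ((x - a (fst k)) * (y - b (snd k)))))"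
      by (simp add: sum_product sum.cartesian_product')
  qed
qed

lemma abelian_int_zeros_le:
  fixes a b :: "nat \<Rightarrow> real" and p q :: "nat \<Rightarrow> nat \<Rightarrow> real" and n :: nat
  assumes K: "K1 \<ge> 1" and inj: "inj_on a {1..K1}" "inj_on b {1..K2}"
    and \<rho>: "\<And>j. j \<in> {1..K1} \<Longrightarrow> \<rho> \<le> \<bar>a j\<bar>" "\<And>l. l \<in> {1..K2} \<Longrightarrow> \<rho> \<le> \<bar>b l\<bar>"
  defines "C \<equiv> (\<lambda>j. (a j)\<^sup>2) ` {1..K1} \<union> (\<lambda>l. (b l)\<^sup>2) ` {1..K2}"
    and "L \<equiv> {(a j)\<^sup>2 + (b l)\<^sup>2 | j l. j \<in> {1..K1} \<and> l \<in> {1..K2}}"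
    and "I \<equiv> abelian_int (poly2 p n) (poly2 q n) (Gfun K1 K2 a b)"
  assumes r0: "0 < r0" "r0 < \<rho>" "I r0 \<noteq> 0"
  shows "zeros_le {0<..<\<rho>} I (if K2 = 0 then card C * ((n + 1) div 2 + 1) + (n div 2 + 1) - 1
    else card C * (n div 2 + 1 + card L) + ((n + 1) div 2 + card L) - 1)"
proof -
  have "\<rho> > 0" using r0 by simp
  have L_eq: "L = (\<lambda>(j, l). (a j)\<^sup>2 + (b l)\<^sup>2) ` ({1..K1} \<times> {1..K2})"
    unfolding L_def by (auto simp del: atLeastAtMost_iff)
  have fin: "finite C" "finite L" by (auto simp: C_def L_eq)
  have sq: "\<rho>\<^sup>2 \<le> x\<^sup>2" if "\<rho> \<le> \<bar>x\<bar>" for x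
    using that \<open>\<rho> > 0\<close> by (metis abs_le_square_iff abs_of_pos)
  have CL: "\<And>c. c \<in> C \<Longrightarrow> \<rho>\<^sup>2 \<le> c" "\<And>l. l \<in> L \<Longrightarrow> \<rho>\<^sup>2 \<le> l"
    using sq \<rho> by (auto simp: C_def L_def intro: add_increasing2)
  have ne: "x \<noteq> a j" if "\<bar>x\<bar> \<le> r" "r < \<rho>" "j \<in> {1..K1}" for x r j using \<rho>(1)[OF that(3)] that by auto
  have ne': "y \<noteq> b l" if "\<bar>y\<bar> \<le> r" "r < \<rho>" "l \<in> {1..K2}" for y r l using \<rho>(2)[OF that(3)] that by auto
  show ?thesis
  proof (cases "K2 = 0")
    case True
    obtain w where w: "\<forall>x. (\<forall>j\<in>{1..K1}. x \<noteq> a j) \<longrightarrow> 1 / (\<Prod>j\<in>{1..K1}. x - a j) = (\<Sum>j\<in>{1..K1}. w j / (x - a j))"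
      using partial_fractions[of "{1..K1}" a] K inj by auto
    have "sqrt_class C \<rho> (n div 2 + 1) ((n + 1) div 2 + 1) (\<lambda>r. (\<Prod>l\<in>L. l - r\<^sup>2) * I r)"
      unfolding I_def
    proof (rule abelian_int_sqrt_class[where K = "{1..K1}" and w = w and g = "\<lambda>j x y. 1 / (x - a j)"])
      fix r x y :: real assume "r < \<rho>" "\<bar>x\<bar> \<le> r"
      then have "\<forall>j\<in>{1..K1}. x \<noteq> a j" using ne by blast
      then show "1 / Gfun K1 K2 a b x y = (\<Sum>j\<in>{1..K1}. w j * (1 / (x - a j)))"
        using w True by (simp add: Gfun_def)
    next
      fix r j assume "0 < r" "r < \<rho>" "j \<in> {1..K1}"
      then show "circ_cont (\<lambda>x y. 1 / (x - a j)) r"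
        using \<rho>(1)[of j] by (intro circ_cont_intros) auto
    next
      fix i j k assume ij: "i + j \<le> n + 1" and k: "k \<in> {1..K1}"
      have "sqrt_class C \<rho> ((i + j + 1) div 2) (j div 2 + 1) (circ_int (\<lambda>x y. x ^ i * y ^ j / (x - a k)))"
        by (rule sqrt_class_monomial_over_linear) (use fin k \<rho> in \<open>auto simp: C_def\<close>)
      then have "sqrt_class C \<rho> (n div 2 + 1) ((n + 1) div 2 + 1) (circ_int (\<lambda>x y. x ^ i * y ^ j / (x - a k)))"
        by (rule sqrt_class_mono) (use ij in linarith)+
      moreover have "L = {}" using True by (simp add: L_eq)
      ultimately show "sqrt_class C \<rho> (n div 2 + 1) ((n + 1) div 2 + 1)
          (\<lambda>r. (\<Prod>l\<in>L. l - r\<^sup>2) * circ_int (\<lambda>x y. x ^ i * y ^ j * (1 / (x - a k))) r)"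
        by simp
    qed simp
    then have "zeros_le {0<..<\<rho>} I (card C * ((n + 1) div 2 + 1) + (n div 2 + 1) - 1)"
      by (rule sqrt_class_zeros_le[where f = I and ?r0.0 = r0, rotated 4]) (use r0 fin CL in auto)
    with True show ?thesis by simp
  next
    case False
    then have "K2 \<ge> 1" by simp
    let ?g = "\<lambda>k x y. 1 / ((x - a (fst k)) * (y - b (snd k)))"
    obtain w where w: "\<forall>x y. (\<forall>j\<in>{1..K1}. x \<noteq> a j) \<longrightarrow> (\<forall>l\<in>{1..K2}. y \<noteq> b l) \<longrightarrow>
        1 / Gfun K1 K2 a b x y = (\<Sum>k\<in>{1..K1}\<times>{1..K2}. w k * ?g k x y)"
      using Gfun_partial_fractions[OF K \<open>K2 \<ge> 1\<close> inj] by blast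
    have "sqrt_class C \<rho> ((n + 1) div 2 + card L) (n div 2 + 1 + card L) (\<lambda>r. (\<Prod>l\<in>L. l - r\<^sup>2) * I r)"
      unfolding I_def
    proof (rule abelian_int_sqrt_class[where K = "{1..K1} \<times> {1..K2}" and w = w and g = ?g])
      fix r x y :: real assume "r < \<rho>" "\<bar>x\<bar> \<le> r" "\<bar>y\<bar> \<le> r"
      then have "\<forall>j\<in>{1..K1}. x \<noteq> a j" "\<forall>l\<in>{1..K2}. y \<noteq> b l" using ne ne' by blast+
      then show "1 / Gfun K1 K2 a b x y = (\<Sum>k\<in>{1..K1}\<times>{1..K2}. w k * ?g k x y)"
        using w by blast
    next
      fix r k assume r: "0 < r" "r < \<rho>" and k: "k \<in> {1..K1} \<times> {1..K2}"
      then have "r < \<bar>a (fst k)\<bar>" "r < \<bar>b (snd k)\<bar>" using \<rho>(1)[of "fst k"] \<rho>(2)[of "snd k"] by auto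
      then show "circ_cont (?g k) r"
        unfolding divide_divide_eq_left[symmetric] using r by (intro circ_cont_intros)
    next
      fix i j k assume ij: "i + j \<le> n + 1" and k: "k \<in> {1..K1} \<times> {1..K2}"
      have "sqrt_class C \<rho> ((n + 1) div 2 + card L) (n div 2 + 1 + card L)
         (\<lambda>r. (\<Prod>l\<in>L. l - r\<^sup>2) * circ_int (\<lambda>x y. x ^ i * y ^ j / ((x - a (fst k)) * (y - b (snd k)))) r)"
        by (rule sqrt_class_monomial_over_bilinear)
          (use fin k \<rho> ij in \<open>auto simp: C_def L_eq simp del: atLeastAtMost_iff\<close>)
      then show "sqrt_class C \<rho> ((n + 1) div 2 + card L) (n div 2 + 1 + card L)
         (\<lambda>r. (\<Prod>l\<in>L. l - r\<^sup>2) * circ_int (\<lambda>x y. x ^ i * y ^ j * ?g k x y) r)"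
        by simp
    qed simp
    then have "zeros_le {0<..<\<rho>} I (card C * (n div 2 + 1 + card L) + ((n + 1) div 2 + card L) - 1)"
      by (rule sqrt_class_zeros_le[where f = I and ?r0.0 = r0, rotated 4]) (use r0 fin CL in auto)
    with False show ?thesis by simp
  qed
qed

theorem theorem1p1:
  fixes K1 K2 n :: nat and a b :: "nat \<Rightarrow> real" and p q :: "nat \<Rightarrow> nat \<Rightarrow> real"
  assumes "K1 \<ge> K2" and "K2 = 0 \<Longrightarrow> K1 \<ge> 1"
    and "inj_on a {1..K1}" and "\<forall>j\<in>{1..K1}. a j \<noteq> 0"
    and "inj_on b {1..K2}" and "\<forall>l\<in>{1..K2}. b l \<noteq> 0"
  defines "\<rho> \<equiv> Min ((\<lambda>j. \<bar>a j\<bar>) ` {1..K1} \<union> (\<lambda>l. \<bar>b l\<bar>) ` {1..K2})"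
    and "I \<equiv> abelian_int (poly2 p n) (poly2 q n) (Gfun K1 K2 a b)"
    and "Kt1 \<equiv> card ((\<lambda>j. \<bar>a j\<bar>) ` {1..K1})"
    and "Kt2 \<equiv> card ((\<lambda>j. \<bar>a j\<bar>) ` {1..K1} \<union> (\<lambda>l. \<bar>b l\<bar>) ` {1..K2}) - card ((\<lambda>j. \<bar>a j\<bar>) ` {1..K1})"
    and "L \<equiv> card {a j ^ 2 + b l ^ 2 | j l. j \<in> {1..K1} \<and> l \<in> {1..K2}}"
  assumes "\<exists>r\<in>{0<..<\<rho>}. I r \<noteq> 0"
  shows "finite {r \<in> {0<..<\<rho>}. I r = 0}
    \<and> (\<forall>r\<in>{0<..<\<rho>}. I r = 0 \<longrightarrow> (\<exists>k. (deriv ^^ k) I r \<noteq> 0))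
    \<and> int (\<Sum>r \<in> {r \<in> {0<..<\<rho>}. I r = 0}. zero_mult I r)
        \<le> (if K2 = 0
            then int Kt1 * ((int n + 3) div 2) + int n div 2
            else int (Kt1 + Kt2) * ((int n + 2) div 2 + int L) + (int n - 1) div 2 + int L)"
proof -
  let ?A = "(\<lambda>j. \<bar>a j\<bar>) ` {1..K1}" and ?B = "(\<lambda>l. \<bar>b l\<bar>) ` {1..K2}"
  define C where "C = (\<lambda>j. (a j)\<^sup>2) ` {1..K1} \<union> (\<lambda>l. (b l)\<^sup>2) ` {1..K2}"
  have K1: "K1 \<ge> 1" using assms(1,2) by (cases "K2 = 0") auto
  have \<rho>: "\<And>j. j \<in> {1..K1} \<Longrightarrow> \<rho> \<le> \<bar>a j\<bar>" "\<And>l. l \<in> {1..K2} \<Longrightarrow> \<rho> \<le> \<bar>b l\<bar>"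
    unfolding \<rho>_def by (intro Min_le; simp)+
  have cardC: "card C = Kt1 + Kt2"
  proof -
    have "C = (\<lambda>x. x\<^sup>2) ` (?A \<union> ?B)" by (auto simp: C_def image_Un image_image)
    moreover have "inj_on (\<lambda>x::real. x\<^sup>2) (?A \<union> ?B)"
      by (rule inj_onI) (auto simp: power2_eq_iff)
    ultimately have "card C = card (?A \<union> ?B)" by (simp add: card_image)
    moreover have "card ?A \<le> card (?A \<union> ?B)" by (intro card_mono) auto
    ultimately show ?thesis by (simp add: Kt1_def Kt2_def)
  qed
  obtain r0 where "0 < r0" "r0 < \<rho>" "I r0 \<noteq> 0" using assms(12) by auto
  from abelian_int_zeros_le[OF K1 assms(3,5) \<rho> this[unfolded I_def]]
  have Z: "zeros_le {0<..<\<rho>} I (if K2 = 0 then card C * ((n + 1) div 2 + 1) + (n div 2 + 1) - 1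
      else card C * (n div 2 + 1 + L) + ((n + 1) div 2 + L) - 1)" (is "zeros_le _ _ ?N")
    unfolding I_def C_def L_def .
  have N: "int ?N = (if K2 = 0 then int Kt1 * ((int n + 3) div 2) + int n div 2
      else int (Kt1 + Kt2) * ((int n + 2) div 2 + int L) + (int n - 1) div 2 + int L)"
  proof (cases "K2 = 0")
    case True
    then have "Kt2 = 0" by (simp add: Kt2_def)
    moreover have "(int n + 3) div 2 = int ((n + 1) div 2 + 1)" by linarith
    ultimately show ?thesis using True by (simp add: cardC zdiv_int distrib_left)
  next
    case False
    have "a 1 ^ 2 + b 1 ^ 2 \<in> {a j ^ 2 + b l ^ 2 | j l. j \<in> {1..K1} \<and> l \<in> {1..K2}}"
      using K1 False by force
    moreover have "finite {a j ^ 2 + b l ^ 2 | j l. j \<in> {1..K1} \<and> l \<in> {1..K2}}"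
      by (rule finite_subset[of _ "(\<lambda>(j, l). a j ^ 2 + b l ^ 2) ` ({1..K1} \<times> {1..K2})"]) auto
    ultimately have "L > 0" unfolding L_def card_gt_0_iff by blast
    then have "int ?N = int (card C) * int (n div 2 + 1 + L) + (int ((n + 1) div 2) - 1) + int L"
      using False by (simp add: of_nat_diff distrib_left)
    also have "int ((n + 1) div 2) - 1 = (int n - 1) div 2" by linarith
    also have "int (n div 2 + 1 + L) = (int n + 2) div 2 + int L" by linarith
    finally show ?thesis using False by (simp only: cardC if_False)
  qed
  show ?thesis
    unfolding N[symmetric] of_nat_le_iff using zeros_le_zero_mult[OF Z] by blast
qed

end
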